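(* Let $\Pi_{yz}=\{x=0\}$ and $\Pi_{yz}^+=\{(x,y,z)\in\mathbb{I}^3:x>0\}$. Let $M^2\subset\Pi_{yz}^+$ be the graph of a function $u:\Omega\subset\Pi_{yz}\to\mathbb{R}$, where $\Omega$ is a bounded domain, and let $\Gamma$ and $A_0$ be the boundary curve and the relative area of $M^2$. Then $M^2$ is a critical point of $$\mathcal{E}_{yz}[M^2]=\int_{M^2}x\,\mathrm{d}A^*-\lambda\int_{M^2}\mathrm{d}A^*=\int_{M^2}(x-\lambda)\,\mathrm{d}A^*$$ in the class $\mathcal{C}^{yz}_{\Gamma,A_0}(\Omega)$ if, and only if, its mean curvature $H$ satisfies $$H(\mathbf r)=\frac{\langle\mathbf N_{par},X\rangle}{2(x-\lambda)}=\frac{\langle\mathbf N_{par},X\rangle}{2\,(d(\mathbf r,\Pi_{yz})-\lambda)},$$ where $X=\partial_x$.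
   Context: The simply isotropic space $\mathbb{I}^3$ is $\mathbb{R}^3$ with coordinates $(x,y,z)$ and the degenerate metric $\langle\mathbf u,\mathbf v\rangle=u^1v^1+u^2v^2$. $\mathcal{C}^{yz}_{\Gamma,A_0}(\Omega)$ is the class of all graphs $G$ over $\Omega$, $G\subset\Pi_{yz}^+$, with boundary $\Gamma$ and relative area $A_0$; $\lambda$ is a Lagrange multiplier due to the constraint on the relative area. The distance from $(x,y,z)$ to $\Pi_{yz}$ is $d=|x|$, equal to $x$ in $\Pi_{yz}^+$, and $X=\partial_x=(1,0,0)$. Surfaces are admissible (no tangent plane contains the direction $(0,0,1)$), hence locally of the normal form $\mathbf r(x,y)=(x,y,f(x,y))$, in which: the mean curvature is $H=\frac{f_{xx}+f_{yy}}{2}$; the parabolic normal is $\mathbf N_{par}=\left(-f_x,-f_y,\frac12-\frac{f_x^2+f_y^2}{2}\right)$; the relative area element is $\mathrm{d}A^*=\frac12(1+f_x^2+f_y^2)\,\mathrm{d}x\,\mathrm{d}y$. *)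

theory Defs
  imports "HOL-Analysis.Analysis"
begin

type_synonym point2 = "real \<times> real"

definition pd1 :: "(point2 \<Rightarrow> real) \<Rightarrow> point2 \<Rightarrow> real"
  where "pd1 f q = deriv (\<lambda>s. f (s, snd q)) (fst q)"

definition pd2 :: "(point2 \<Rightarrow> real) \<Rightarrow> point2 \<Rightarrow> real"
  where "pd2 f q = deriv (\<lambda>s. f (fst q, s)) (snd q)"

(* These two notions are only meant for open S. *)
definition C1_on :: "point2 set \<Rightarrow> (point2 \<Rightarrow> real) \<Rightarrow> bool"
  where "C1_on S f \<longleftrightarrow>
    f differentiable_on S \<and> continuous_on S (pd1 f) \<and> continuous_on S (pd2 f)"

definition C2_on :: "point2 set \<Rightarrow> (point2 \<Rightarrow> real) \<Rightarrow> bool"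
  where "C2_on S f \<longleftrightarrow> C1_on S f \<and> C1_on S (pd1 f) \<and> C1_on S (pd2 f)"

type_synonym point3 = "real \<times> real \<times> real"

fun iso_inner :: "point3 \<Rightarrow> point3 \<Rightarrow> real"
  where "iso_inner (u1, u2, u3) (v1, v2, v3) = u1 * v1 + u2 * v2"

definition iso_dist :: "point3 \<Rightarrow> point3 \<Rightarrow> real"
  where "iso_dist p q = sqrt (iso_inner (p - q) (p - q))"

definition iso_dist_set :: "point3 \<Rightarrow> point3 set \<Rightarrow> real"
  where "iso_dist_set p S = (INF q\<in>S. iso_dist p q)"

definition plane_yz :: "point3 set"
  where "plane_yz = {p. fst p = 0}"

definition half_space_yz :: "point3 set"
  where "half_space_yz = {p. fst p > 0}"

definition X_field :: point3
  where "X_field = (1, 0, 0)"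

definition normal_form_at :: "point3 set \<Rightarrow> point3 \<Rightarrow> (point2 \<Rightarrow> real) \<Rightarrow> bool"
  where "normal_form_at M p f \<longleftrightarrow>
    (\<exists>U W. open U \<and> open W \<and> p \<in> W \<and> p \<in> M \<and> C2_on U f \<and>
       M \<inter> W = (\<lambda>(x, y). (x, y, f (x, y))) ` U)"

(* Two normal forms of M at p agree near the top view of p, so the quantities
   below, which only involve derivatives there, do not depend on the choice.
   A normal form exists at every point of an admissible surface. *)
definition normal_form :: "point3 set \<Rightarrow> point3 \<Rightarrow> point2 \<Rightarrow> real"
  where "normal_form M p = (SOME f. normal_form_at M p f)"

fun top_view :: "point3 \<Rightarrow> point2"
  where "top_view (x, y, z) = (x, y)"

definition mean_curvature :: "point3 set \<Rightarrow> point3 \<Rightarrow> real"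
  where "mean_curvature M p =
    (let f = normal_form M p; q = top_view p
     in (pd1 (pd1 f) q + pd2 (pd2 f) q) / 2)"

definition N_par :: "point3 set \<Rightarrow> point3 \<Rightarrow> point3"
  where "N_par M p =
    (let f = normal_form M p; q = top_view p
     in (- pd1 f q, - pd2 f q, 1 / 2 - ((pd1 f q)\<^sup>2 + (pd2 f q)\<^sup>2) / 2))"

(* The factor of dx dy in the relative area element. *)
definition rel_area_factor :: "point3 set \<Rightarrow> point3 \<Rightarrow> real"
  where "rel_area_factor M p =
    (let f = normal_form M p; q = top_view p
     in (1 + (pd1 f q)\<^sup>2 + (pd2 f q)\<^sup>2) / 2)"

(* A point (y, z) of the domain stands for (0, y, z) in plane_yz. *)
definition graph_point :: "(point2 \<Rightarrow> real) \<Rightarrow> point2 \<Rightarrow> point3"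
  where "graph_point u q = (u q, fst q, snd q)"

definition graph_yz :: "point2 set \<Rightarrow> (point2 \<Rightarrow> real) \<Rightarrow> point3 set"
  where "graph_yz \<Omega> u = graph_point u ` \<Omega>"

(* For u continuous on the closure of the domain. *)
definition boundary_yz :: "point2 set \<Rightarrow> (point2 \<Rightarrow> real) \<Rightarrow> point3 set"
  where "boundary_yz \<Omega> u = graph_point u ` frontier \<Omega>"

(* The tangent plane at graph_point u q is spanned by the two partial derivatives
   of graph_point u at q. *)
definition admissible_yz :: "point2 set \<Rightarrow> (point2 \<Rightarrow> real) \<Rightarrow> bool"
  where "admissible_yz \<Omega> u \<longleftrightarrow>
    (\<forall>q\<in>\<Omega>. ((0, 0, 1) :: point3) \<notin> span {(pd1 u q, 1, 0), (pd2 u q, 0, 1)})"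

(* The relative area element pulled back to the (y, z)-plane: the top view
   (y, z) |-> (u (y, z), y) of the graph has Jacobian determinant - pd2 u, so
   dx dy becomes \<bar>pd2 u\<bar> dy dz. *)
definition rel_area_density :: "point2 set \<Rightarrow> (point2 \<Rightarrow> real) \<Rightarrow> point2 \<Rightarrow> real"
  where "rel_area_density \<Omega> u q =
    rel_area_factor (graph_yz \<Omega> u) (graph_point u q) * \<bar>pd2 u q\<bar>"

definition rel_integral :: "point2 set \<Rightarrow> (point2 \<Rightarrow> real) \<Rightarrow> (point3 \<Rightarrow> real) \<Rightarrow> real"
  where "rel_integral \<Omega> u g =
    (LINT q:\<Omega>|lborel. g (graph_point u q) * rel_area_density \<Omega> u q)"

definition has_rel_area :: "point2 set \<Rightarrow> (point2 \<Rightarrow> real) \<Rightarrow> real \<Rightarrow> bool"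
  where "has_rel_area \<Omega> u A \<longleftrightarrow>
    set_integrable lborel \<Omega> (rel_area_density \<Omega> u) \<and> rel_integral \<Omega> u (\<lambda>_. 1) = A"

(* Graphs are represented by their height functions. *)
definition graph_class ::
    "point2 set \<Rightarrow> point3 set \<Rightarrow> real \<Rightarrow> (point2 \<Rightarrow> real) set"
  where "graph_class \<Omega> \<Gamma> A0 =
    {u. C2_on \<Omega> u \<and> continuous_on (closure \<Omega>) u \<and> admissible_yz \<Omega> u \<and>
        graph_yz \<Omega> u \<subseteq> half_space_yz \<and> boundary_yz \<Omega> u = \<Gamma> \<and> has_rel_area \<Omega> u A0}"

definition energy_yz :: "point2 set \<Rightarrow> real \<Rightarrow> (point2 \<Rightarrow> real) \<Rightarrow> real"
  where "energy_yz \<Omega> lam u =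
    rel_integral \<Omega> u (\<lambda>p. fst p) - lam * rel_integral \<Omega> u (\<lambda>_. 1)"

definition variation_field :: "point2 set \<Rightarrow> (point2 \<Rightarrow> real) \<Rightarrow> bool"
  where "variation_field \<Omega> \<phi> \<longleftrightarrow>
    C2_on UNIV \<phi> \<and> (\<exists>K. compact K \<and> K \<subseteq> \<Omega> \<and> (\<forall>q. q \<notin> K \<longrightarrow> \<phi> q = 0))"

(* The constraint on the relative area enters through membership in the class
   and through the multiplier term of the energy. As usual for a Lagrange
   multiplier, the variations of u keep the boundary fixed (and, for small t,
   stay admissible graphs in the half-space) but need not keep the relative
   area: restricted to area-preserving variations, the multiplier term would be
   constant and criticality could not depend on lam. *)
definition critical_point_yz ::
    "point2 set \<Rightarrow> point3 set \<Rightarrow> real \<Rightarrow> real \<Rightarrow> (point2 \<Rightarrow> real) \<Rightarrow> bool"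
  where "critical_point_yz \<Omega> \<Gamma> A0 lam u \<longleftrightarrow>
    u \<in> graph_class \<Omega> \<Gamma> A0 \<and>
    (\<forall>\<phi>. variation_field \<Omega> \<phi> \<longrightarrow>
      ((\<lambda>t. energy_yz \<Omega> lam (\<lambda>q. u q + t * \<phi> q)) has_real_derivative 0) (at 0))"

end

theory Submission
  imports Defs
begin

text \<open>
  Write \<open>p\<close>, \<open>q\<close> for the partial derivatives of \<open>u\<close> in \<open>y\<close> and \<open>z\<close>; admissibility means \<open>q \<noteq> 0\<close>,
  so \<open>q\<close> has a constant sign \<open>\<sigma>\<close>. A normal form \<open>f\<close> of the graph satisfies \<open>u (y, f (x, y)) = x\<close>,
  hence \<open>f\<^sub>x = 1 / q\<close> and \<open>f\<^sub>y = - p / q\<close>, and the energy becomes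
  \<open>\<integral> (u - lam) (1 + p\<^sup>2 + q\<^sup>2) / (2 \<sigma> q) dy dz\<close>. Differentiating the normal form once more shows that
  its Euler-Lagrange expression is \<open>\<sigma> (1 / q + 2 H (u - lam))\<close>, while \<open>\<langle>N_par, X\<rangle> = - 1 / q\<close>. Since
  \<open>1 / q\<close> never vanishes, the Euler-Lagrange equation also forces \<open>u \<noteq> lam\<close>.
\<close>

section \<open>Partial derivatives in the plane\<close>

text \<open>\<open>normal_form\<close> is a Hilbert choice, so curvature, normal and area factor say
  nothing until some normal form exists at each point. The local inversion of
  \<open>(y, z) |-> (u (y, z), y)\<close> is therefore carried out in full, and every formula is
  proved for an arbitrary local solution of \<open>u (y, f (x, y)) = x\<close>. The other obstacle
  is the boundary: the area density is integrable but may blow up at the frontier of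
  \<open>\<Omega>\<close>, whose shape is arbitrary. Hence only the change of the energy relative to
  t = 0 is differentiated. Its integrand vanishes off the compact support of the variation and
  extends continuously by zero to a box, where Leibniz's rule and Fubini's theorem apply. The
  regularity is just sufficient: \<open>u\<close> of class C2 makes the derivatives of the
  Lagrangian in p and q of class C1, enough for one integration by parts.\<close>

abbreviation has_partials :: "(point2 \<Rightarrow> real) \<Rightarrow> real \<Rightarrow> real \<Rightarrow> point2 \<Rightarrow> bool"
  where "has_partials f a b q \<equiv> (f has_derivative (\<lambda>h. a * fst h + b * snd h)) (at q)"

lemma has_partials_fst:
  assumes "has_partials f a b q"
  shows "((\<lambda>s. f (s, snd q)) has_field_derivative a) (at (fst q))"
proof -
  have "((\<lambda>s. (s, snd q)) has_derivative (\<lambda>h. (h, 0))) (at (fst q))"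
    by (auto intro!: derivative_eq_intros)
  from has_derivative_compose[OF this, of f] assms
  show ?thesis unfolding has_field_derivative_def by fastforce
qed

lemma has_partials_snd:
  assumes "has_partials f a b q"
  shows "((\<lambda>s. f (fst q, s)) has_field_derivative b) (at (snd q))"
proof -
  have "((\<lambda>s. (fst q, s)) has_derivative (\<lambda>h. (0, h))) (at (snd q))"
    by (auto intro!: derivative_eq_intros)
  from has_derivative_compose[OF this, of f] assms
  show ?thesis unfolding has_field_derivative_def by fastforce
qed

lemma has_partials_pd:
  assumes "has_partials f a b q"
  shows "pd1 f q = a" "pd2 f q = b"
  using has_partials_fst[OF assms] has_partials_snd[OF assms]
  by (simp_all add: pd1_def pd2_def DERIV_imp_deriv)

text \<open>A linear map of the plane is determined by its values at the two unit vectors, and these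
  are what the one-variable derivatives \<open>pd1\<close> and \<open>pd2\<close> read off.\<close>

lemma differentiable_has_partials:
  assumes "f differentiable (at q)"
  shows "has_partials f (pd1 f q) (pd2 f q) q"
proof -
  from assms obtain D where D: "(f has_derivative D) (at q)"
    unfolding differentiable_def by blast
  then interpret bounded_linear D by (rule has_derivative_bounded_linear)
  have "D h = D (1, 0) * fst h + D (0, 1) * snd h" for h :: point2
  proof -
    have "h = fst h *\<^sub>R (1, 0) + snd h *\<^sub>R (0, 1)" by (simp add: prod_eq_iff)
    then have "D h = D (fst h *\<^sub>R (1, 0) + snd h *\<^sub>R (0, 1))" by simp
    also have "\<dots> = D (1, 0) * fst h + D (0, 1) * snd h" by (simp only: add scaleR) simp
    finally show ?thesis .
  qed
  then have "D = (\<lambda>h. D (1, 0) * fst h + D (0, 1) * snd h)" by (rule ext)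
  with D have "has_partials f (D (1, 0)) (D (0, 1)) q" by simp
  with has_partials_pd[OF this] show ?thesis by simp
qed

lemma C1_on_has_partials:
  assumes "C1_on S f" "open S" "q \<in> S"
  shows "has_partials f (pd1 f q) (pd2 f q) q"
  using assms unfolding C1_on_def differentiable_on_def
  by (metis at_within_open differentiable_has_partials)

lemma C1_onI:
  assumes "open S" and f: "\<And>q. q \<in> S \<Longrightarrow> has_partials f (a q) (b q) q"
    and "continuous_on S a" "continuous_on S b"
  shows "C1_on S f"
  unfolding C1_on_def
proof (intro conjI)
  show "f differentiable_on S"
    unfolding differentiable_on_def using f differentiable_at_withinI differentiableI by blast
  show "continuous_on S (pd1 f)" "continuous_on S (pd2 f)"
    using assms has_partials_pd[OF f] by (auto cong: continuous_on_cong_simp)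
qed

lemma has_partials_cong:
  assumes "has_partials f a b q" "open S" "q \<in> S" "\<And>r. r \<in> S \<Longrightarrow> f r = g r"
  shows "has_partials g a b q"
  using has_derivative_transform_within_open[OF assms(1-3)] assms(4) by blast

lemma has_partials_continuous_on:
  assumes "\<And>q. q \<in> S \<Longrightarrow> has_partials f (a q) (b q) q"
  shows "continuous_on S f"
  using assms by (meson continuous_at_imp_continuous_on has_derivative_continuous)

lemma has_partials_mult:
  assumes "has_partials f a b q" "has_partials g c d q"
  shows "has_partials (\<lambda>q. f q * g q) (a * g q + f q * c) (b * g q + f q * d) q"
  by (rule has_derivative_eq_rhs[OF has_derivative_mult[OF assms]]) (auto simp: algebra_simps)

lemma has_partials_add:
  assumes "has_partials f a b q" "has_partials g c d q"
  shows "has_partials (\<lambda>q. f q + g q) (a + c) (b + d) q"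
  by (rule has_derivative_eq_rhs[OF has_derivative_add[OF assms]]) (auto simp: algebra_simps)

lemma has_partials_const: "has_partials (\<lambda>q. c) 0 0 q"
  by simp

lemma has_partials_inverse:
  assumes "has_partials g c d q" "g q \<noteq> 0"
  shows "has_partials (\<lambda>q. 1 / g q) (- c / (g q)\<^sup>2) (- d / (g q)\<^sup>2) q"
proof -
  have "((\<lambda>q. inverse (g q)) has_derivative
      (\<lambda>h. - (inverse (g q) * (c * fst h + d * snd h) * inverse (g q)))) (at q)"
    using assms(2,1) by (rule Deriv.has_derivative_inverse)
  then show ?thesis
    by (auto simp: inverse_eq_divide power2_eq_square algebra_simps add_divide_distrib diff_divide_distrib elim!: has_derivative_eq_rhs)
qed

text \<open>The substitution is \<open>(x, y) |-> (y, f (x, y))\<close>: the first argument of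
  \<open>g\<close> is the second coordinate of \<open>r\<close>, so \<open>a\<close> enters only the
  second partial.\<close>

lemma has_partials_along_graph:
  assumes "has_partials g a b (snd r, f r)" "has_partials f c d r"
  shows "has_partials (\<lambda>r. g (snd r, f r)) (b * c) (a + b * d) r"
proof -
  have "((\<lambda>r. (snd r, f r)) has_derivative (\<lambda>h. (snd h, c * fst h + d * snd h))) (at r)"
    by (intro has_derivative_Pair assms) (auto intro!: derivative_eq_intros)
  from has_derivative_compose[OF this assms(1)] show ?thesis
    by (auto simp: algebra_simps elim!: has_derivative_eq_rhs)
qed

section \<open>Normal forms of a graph over the yz-plane\<close>

text \<open>The last two coordinates force the coefficients s = 0 and t = 1, which leaves
  \<open>b = 0\<close> in the first coordinate.\<close>

lemma vertical_notin_span_iff: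
  "((0, 0, 1) :: point3) \<notin> span {(a, 1, 0), (b, 0, 1)} \<longleftrightarrow> b \<noteq> 0"
proof -
  have "((0, 0, 1) :: point3) \<in> span {(a, 1, 0), (b, 0, 1)}
      \<longleftrightarrow> (\<exists>s t. (0, 0, 1) - s *\<^sub>R (a, 1, 0) - t *\<^sub>R (b, 0, 1) = (0 :: point3))"
    by (simp only: span_insert span_empty mem_Collect_eq singleton_iff)
  also have "\<dots> \<longleftrightarrow> b = 0"
  proof -
    have "(0, 0, 1) - s *\<^sub>R (a, 1, 0) - t *\<^sub>R (b, 0, 1) = (0 :: point3)
        \<longleftrightarrow> s = 0 \<and> t = 1 \<and> b = 0" for s t
      unfolding prod_eq_iff by auto
    then show ?thesis by simp
  qed
  finally show ?thesis by blast
qed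

lemma admissible_yz_iff: "admissible_yz \<Omega> u \<longleftrightarrow> (\<forall>q\<in>\<Omega>. pd2 u q \<noteq> 0)"
  unfolding admissible_yz_def vertical_notin_span_iff ..

lemma C2_on_has_partials:
  assumes "C2_on S f" "open S" "q \<in> S"
  shows "has_partials f (pd1 f q) (pd2 f q) q"
    and "has_partials (pd1 f) (pd1 (pd1 f) q) (pd2 (pd1 f) q) q"
    and "has_partials (pd2 f) (pd1 (pd2 f) q) (pd2 (pd2 f) q) q"
  using assms C1_on_has_partials unfolding C2_on_def by blast+

lemma C2_on_continuous:
  assumes "C2_on S f" "open S"
  shows "continuous_on S f" "continuous_on S (pd1 f)" "continuous_on S (pd2 f)"
    "continuous_on S (pd1 (pd1 f))" "continuous_on S (pd2 (pd1 f))"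
    "continuous_on S (pd1 (pd2 f))" "continuous_on S (pd2 (pd2 f))"
  using assms C2_on_has_partials[OF assms] has_partials_continuous_on
  unfolding C2_on_def C1_on_def by blast+

text \<open>Implicit differentiation of \<open>u (y, f (x, y)) = x\<close>. Differentiability is all
  that is asked of \<open>f\<close>, so that the local inverse constructed below can be inserted
  before it is known to be C2.\<close>

lemma graph_inverse_partials:
  assumes u: "C2_on \<Omega> u" "open \<Omega>" and nz: "\<forall>q\<in>\<Omega>. pd2 u q \<noteq> 0"
    and U: "open U" and f: "f differentiable_on U"
    and inv: "\<forall>r\<in>U. (snd r, f r) \<in> \<Omega> \<and> u (snd r, f r) = fst r"
    and r: "r \<in> U" and w: "w = (snd r, f r)"
  shows "has_partials f (1 / pd2 u w) (- pd1 u w / pd2 u w) r"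
proof -
  have fp: "has_partials f (pd1 f r) (pd2 f r) r"
    using f r U at_within_open differentiable_has_partials
    unfolding differentiable_on_def by metis
  have w\<Omega>: "w \<in> \<Omega>" using inv r w by blast
  have "has_partials (\<lambda>r. u (snd r, f r)) (pd2 u w * pd1 f r) (pd1 u w + pd2 u w * pd2 f r) r"
    using has_partials_along_graph[OF _ fp] C2_on_has_partials(1)[OF u w\<Omega>] w by blast
  then have "has_partials fst (pd2 u w * pd1 f r) (pd1 u w + pd2 u w * pd2 f r) r"
    by (rule has_partials_cong[OF _ U r]) (use inv in auto)
  moreover have "has_partials fst 1 0 r" by (auto intro!: derivative_eq_intros)
  ultimately have "pd2 u w * pd1 f r = 1" "pd1 u w + pd2 u w * pd2 f r = 0"
    using has_partials_pd by metis+
  with bspec[OF nz w\<Omega>] have "pd1 f r = 1 / pd2 u w" "pd2 f r = - pd1 u w / pd2 u w"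
    by (auto simp: field_simps add_eq_0_iff)
  with fp show ?thesis by simp
qed

text \<open>The formulas \<open>1 / q\<close> and \<open>- p / q\<close> hold on all of
  \<open>U\<close> and may be differentiated again along \<open>(snd r, f r)\<close>; the chain rule
  contributes a further factor \<open>1 / q\<close> or \<open>- p / q\<close>, whence the powers up
  to \<open>q ^ 3\<close>.\<close>

lemma graph_inverse_second_partials:
  assumes u: "C2_on \<Omega> u" "open \<Omega>" and nz: "\<forall>q\<in>\<Omega>. pd2 u q \<noteq> 0"
    and U: "open U" and f: "f differentiable_on U"
    and inv: "\<forall>r\<in>U. (snd r, f r) \<in> \<Omega> \<and> u (snd r, f r) = fst r"
    and r: "r \<in> U" and w: "w = (snd r, f r)"
  defines "p \<equiv> pd1 u w" and "q \<equiv> pd2 u w"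
    and "a \<equiv> pd1 (pd1 u) w" and "b \<equiv> pd2 (pd1 u) w"
    and "c \<equiv> pd1 (pd2 u) w" and "d \<equiv> pd2 (pd2 u) w"
  shows "has_partials (pd1 f) (- d / q ^ 3) (- c / q\<^sup>2 + p * d / q ^ 3) r"
    and "has_partials (pd2 f) (- b / q\<^sup>2 + p * d / q ^ 3)
      (- a / q + p * c / q\<^sup>2 + p * b / q\<^sup>2 - p\<^sup>2 * d / q ^ 3) r"
proof -
  note fp = graph_inverse_partials[OF u nz U f inv]
  have w\<Omega>: "w \<in> \<Omega>" using inv r w by blast
  have q0: "q \<noteq> 0" unfolding q_def using nz w\<Omega> by blast
  have fr: "has_partials f (1 / q) (- p / q) r"
    unfolding p_def q_def by (rule fp[OF r w])
  note up = C2_on_has_partials[OF u w\<Omega>]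
  have invq: "has_partials (\<lambda>q. 1 / pd2 u q) (- c / q\<^sup>2) (- d / q\<^sup>2) w"
    unfolding q_def c_def d_def by (rule has_partials_inverse[OF up(3)]) (use nz w\<Omega> in blast)
  have m: "has_partials (\<lambda>q. - 1 * (pd1 u q * (1 / pd2 u q)))
      (- 1 * (a * (1 / q) + p * (- c / q\<^sup>2))) (- 1 * (b * (1 / q) + p * (- d / q\<^sup>2))) w"
    using has_partials_mult[OF has_partials_const[of "-1"] has_partials_mult[OF up(2) invq]]
    unfolding q_def p_def a_def b_def by simp
  have "has_partials (\<lambda>r. 1 / pd2 u (snd r, f r)) (- d / q\<^sup>2 * (1 / q))
      (- c / q\<^sup>2 + - d / q\<^sup>2 * (- p / q)) r"
    using has_partials_along_graph[OF _ fr] invq w by blast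
  then have "has_partials (pd1 f) (- d / q\<^sup>2 * (1 / q)) (- c / q\<^sup>2 + - d / q\<^sup>2 * (- p / q)) r"
    by (rule has_partials_cong[OF _ U r]) (use has_partials_pd(1)[OF fp] in auto)
  moreover have "- d / q\<^sup>2 * (1 / q) = - d / q ^ 3"
    "- c / q\<^sup>2 + - d / q\<^sup>2 * (- p / q) = - c / q\<^sup>2 + p * d / q ^ 3"
    using q0 by (auto simp: field_simps power2_eq_square power3_eq_cube)
  ultimately show "has_partials (pd1 f) (- d / q ^ 3) (- c / q\<^sup>2 + p * d / q ^ 3) r"
    by (simp only:)
  let ?b = "- 1 * (b * (1 / q) + p * (- d / q\<^sup>2))"
  let ?a = "- 1 * (a * (1 / q) + p * (- c / q\<^sup>2))"
  have "has_partials (\<lambda>r. - 1 * (pd1 u (snd r, f r) * (1 / pd2 u (snd r, f r))))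
      (?b * (1 / q)) (?a + ?b * (- p / q)) r"
    using has_partials_along_graph[OF _ fr] m w by blast
  then have "has_partials (pd2 f) (?b * (1 / q)) (?a + ?b * (- p / q)) r"
    by (rule has_partials_cong[OF _ U r]) (use has_partials_pd(2)[OF fp] in auto)
  moreover have "?b * (1 / q) = - b / q\<^sup>2 + p * d / q ^ 3"
    "?a + ?b * (- p / q) = - a / q + p * c / q\<^sup>2 + p * b / q\<^sup>2 - p\<^sup>2 * d / q ^ 3"
    using q0 by (auto simp: field_simps power2_eq_square power3_eq_cube)
  ultimately show "has_partials (pd2 f) (- b / q\<^sup>2 + p * d / q ^ 3)
      (- a / q + p * c / q\<^sup>2 + p * b / q\<^sup>2 - p\<^sup>2 * d / q ^ 3) r"
    by (simp only:)
qed

text \<open>A bootstrap: the derivatives of \<open>f\<close> up to order two are rational in those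
  of \<open>u\<close> along the continuous map \<open>r |-> (snd r, f r)\<close>, with powers of
  \<open>pd2 u\<close> as the only denominators.\<close>

lemma graph_inverse_C2_on:
  assumes u: "C2_on \<Omega> u" "open \<Omega>" and nz: "\<forall>q\<in>\<Omega>. pd2 u q \<noteq> 0"
    and U: "open U" and f: "f differentiable_on U"
    and inv: "\<forall>r\<in>U. (snd r, f r) \<in> \<Omega> \<and> u (snd r, f r) = fst r"
  shows "C2_on U f"
proof -
  note fp = graph_inverse_partials[OF u nz U f inv _ refl]
  note fp2 = graph_inverse_second_partials[OF u nz U f inv _ refl]
  have "continuous_on U (\<lambda>r. (snd r, f r))"
    using f by (intro continuous_intros differentiable_imp_continuous_on)
  moreover have "(\<lambda>r. (snd r, f r)) ` U \<subseteq> \<Omega>" using inv by auto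
  ultimately have comp: "continuous_on U (\<lambda>r. g (snd r, f r))"
    if "continuous_on \<Omega> g" for g :: "point2 \<Rightarrow> real"
    using continuous_on_compose2 that by blast
  note [continuous_intros] = C2_on_continuous[OF u, THEN comp]
  have nzU: "pd2 u (snd r, f r) \<noteq> 0" if "r \<in> U" for r
    using nz inv that by blast
  show ?thesis
    unfolding C2_on_def
  proof (intro conjI)
    show "C1_on U f"
      by (rule C1_onI[OF U fp]) (use nzU in \<open>auto intro!: continuous_intros\<close>)
    show "C1_on U (pd1 f)"
      by (rule C1_onI[OF U fp2(1)]) (use nzU in \<open>auto intro!: continuous_intros\<close>)
    show "C1_on U (pd2 f)"
      by (rule C1_onI[OF U fp2(2)]) (use nzU in \<open>auto intro!: continuous_intros\<close>)
  qed
qed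

text \<open>The top view, read in the parameter plane, is \<open>(y, z) |-> (u (y, z), y)\<close>.
  Its Jacobian determinant is \<open>- pd2 u\<close>, so it is locally invertible, and
  \<open>f\<close> is the second component of the inverse.\<close>

lemma normal_form_at_graph_yz:
  assumes u: "C2_on \<Omega> u" "open \<Omega>" and nz: "\<forall>q\<in>\<Omega>. pd2 u q \<noteq> 0"
    and q: "q \<in> \<Omega>"
  shows "\<exists>f. normal_form_at (graph_yz \<Omega> u) (graph_point u q) f"
proof -
  obtain e where e: "e > 0" "ball q e \<subseteq> \<Omega>"
    using u(2) q openE by blast
  define B where "B = ball q e"
  have B: "open B" "convex B" "B \<subseteq> \<Omega>" "q \<in> B" using e unfolding B_def by auto
  define F where "F = (\<lambda>w. (u w, fst w))"
  have inj: "inj_on F B"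
  proof (rule inj_onI)
    fix v w assume vw: "v \<in> B" "w \<in> B" "F v = F w"
    then have eq: "fst v = fst w" "u v = u w" by (auto simp: F_def)
    show "v = w"
    proof (rule ccontr)
      assume "v \<noteq> w"
      with eq have "snd v \<noteq> snd w" by (simp add: prod_eq_iff)
      \<comment> \<open>Two points on one vertical segment of the ball with equal values of
        \<open>u\<close> would give a zero of \<open>pd2 u\<close> between them, by the mean value
        theorem. The order \<open>snd x < snd y\<close> is no restriction, as \<open>v\<close> and
        \<open>w\<close> enter symmetrically.\<close>
      moreover have False if xy: "x \<in> B" "y \<in> B" "fst x = fst y" "u x = u y" "snd x < snd y" for x y
      proof -
        have seg: "(fst x, s) \<in> B" if "snd x \<le> s" "s \<le> snd y" for s
        proof -
          have "s \<in> closed_segment (snd x) (snd y)"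
            using that xy by (simp add: closed_segment_eq_real_ivl)
          then obtain t where t: "0 \<le> t" "t \<le> 1" "s = (1 - t) * snd x + t * snd y"
            by (auto simp: closed_segment_def)
          have "(1 - t) *\<^sub>R x + t *\<^sub>R y \<in> B"
            using convexD_alt[OF B(2) xy(1,2) t(1,2)] .
          moreover have "(1 - t) *\<^sub>R x + t *\<^sub>R y = (fst x, s)"
            using xy(3) t by (simp add: prod_eq_iff algebra_simps)
          ultimately show ?thesis by simp
        qed
        have der: "((\<lambda>s. u (fst x, s)) has_real_derivative pd2 u (fst x, s)) (at s)"
          if "snd x \<le> s" "s \<le> snd y" for s
          using has_partials_snd[OF C2_on_has_partials(1)[OF u]] seg[OF that] B(3) by fastforce
        obtain z where z: "snd x < z" "z < snd y"
          "u (fst x, snd y) - u (fst x, snd x) = (snd y - snd x) * pd2 u (fst x, z)"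
          using MVT2[OF xy(5) der] by blast
        moreover have "u (fst x, snd y) = u (fst x, snd x)"
          using xy by (metis prod.collapse)
        moreover have "pd2 u (fst x, z) \<noteq> 0" using nz seg[of z] z B(3) by fastforce
        ultimately show False using xy(5) by simp
      qed
      ultimately show False using vw eq by (metis linorder_neqE_linordered_idom)
    qed
  qed
  define G where "G = inv_into B F"
  have GF: "G (F w) = w" if "w \<in> B" for w
    unfolding G_def using inj that by (rule inv_into_f_f)
  have contF: "continuous_on B F"
    unfolding F_def by (intro continuous_intros continuous_on_subset[OF C2_on_continuous(1)[OF u] B(3)])
  define U where "U = F ` B"
  \<comment> \<open>Continuity and injectivity suffice for an open image; the derivative of the
    inverse is computed separately.\<close>
  have U: "open U" unfolding U_def by (rule invariance_of_domain[OF contF B(1) inj])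
  have FG: "G r \<in> B" "F (G r) = r" if "r \<in> U" for r
    using that GF unfolding U_def by auto
  define f where "f = (\<lambda>r. snd (G r))"
  have G: "G r = (snd r, f r)" if "r \<in> U" for r
    using FG(2)[OF that] unfolding F_def f_def by (metis prod.collapse snd_conv)
  have "f differentiable_on U"
    unfolding differentiable_on_def
  proof
    fix r assume r: "r \<in> U"
    define F' where "F' = (\<lambda>w h. (pd1 u w * fst h + pd2 u w * snd h, fst h))"
    \<comment> \<open>The inverse of the matrix of \<open>F'\<close>, whose rows are
      \<open>(pd1 u w, pd2 u w)\<close> and \<open>(1, 0)\<close>.\<close>
    define G' where "G' = (\<lambda>w (k :: point2). (snd k, (fst k - pd1 u w * snd k) / pd2 u w))"
    have "(F has_derivative F' w) (at w)" if "w \<in> B" for w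
      unfolding F_def F'_def
      by (intro has_derivative_Pair C2_on_has_partials(1)[OF u])
        (use that B(3) in \<open>auto intro!: derivative_eq_intros\<close>)
    moreover have "F' (G r) \<circ> G' (G r) = id"
      using bspec[OF nz, of "G r"] FG(1)[OF r] B(3) by (auto simp: F'_def G'_def fun_eq_iff)
    ultimately have "(G has_derivative G' (G r)) (at (F (G r)))"
      using has_derivative_inverse_on[where S = B and f = F and f' = F' and g = G and x = "G r" and g' = G', OF B(1)] GF FG(1)[OF r] by blast
    then have "(G has_derivative G' (G r)) (at r)" using FG(2)[OF r] by simp
    then have "(f has_derivative (\<lambda>k. snd (G' (G r) k))) (at r)"
      unfolding f_def by (rule has_derivative_snd)
    then show "f differentiable at r within U"
      using differentiable_at_withinI differentiableI by blast
  qed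
  then have C2: "C2_on U f"
  proof (rule graph_inverse_C2_on[OF u nz U], intro ballI)
    fix r assume r: "r \<in> U"
    have "G r \<in> \<Omega>" using FG(1)[OF r] B(3) by blast
    moreover have "u (G r) = fst r" using FG(2)[OF r] unfolding F_def by (metis fst_conv)
    ultimately show "(snd r, f r) \<in> \<Omega> \<and> u (snd r, f r) = fst r" using G[OF r] by simp
  qed
  \<comment> \<open>A cylinder in the x-direction: since a graph point carries its parameter in its
    last two coordinates, this cuts out exactly the part of the graph over \<open>B\<close>.\<close>
  define W :: "point3 set" where "W = UNIV \<times> B"
  have "open W" unfolding W_def using B(1) by (simp add: open_Times)
  moreover have "graph_yz \<Omega> u \<inter> W = (\<lambda>(x, y). (x, y, f (x, y))) ` U"
  proof -
    have "graph_yz \<Omega> u \<inter> W = graph_point u ` B"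
      using B(3) by (auto simp: graph_yz_def graph_point_def W_def)
    also have "\<dots> = (\<lambda>(x, y). (x, y, f (x, y))) ` U"
      unfolding U_def image_image
      by (rule image_cong) (auto simp: graph_point_def F_def f_def GF[unfolded F_def])
    finally show ?thesis .
  qed
  ultimately have "normal_form_at (graph_yz \<Omega> u) (graph_point u q) f"
    unfolding normal_form_at_def using U C2 q B(4)
    by (intro exI[of _ U] exI[of _ W]) (auto simp: graph_yz_def W_def graph_point_def)
  then show ?thesis by blast
qed

text \<open>The chosen normal form parametrizes a piece of the graph, so it solves
  \<open>u (y, f (x, y)) = x\<close> on its domain. That equation fixes the derivatives, and the
  choice drops out.\<close>

lemma normal_form_derivatives:
  assumes u: "C2_on \<Omega> u" "open \<Omega>" and nz: "\<forall>q\<in>\<Omega>. pd2 u q \<noteq> 0"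
    and w: "w \<in> \<Omega>"
  defines "f \<equiv> normal_form (graph_yz \<Omega> u) (graph_point u w)"
    and "r \<equiv> top_view (graph_point u w)"
    and "p \<equiv> pd1 u w" and "q \<equiv> pd2 u w"
  shows "pd1 f r = 1 / q" and "pd2 f r = - p / q"
    and "pd1 (pd1 f) r = - pd2 (pd2 u) w / q ^ 3"
    and "pd2 (pd2 f) r = - pd1 (pd1 u) w / q + p * pd1 (pd2 u) w / q\<^sup>2
      + p * pd2 (pd1 u) w / q\<^sup>2 - p\<^sup>2 * pd2 (pd2 u) w / q ^ 3"
proof -
  have "normal_form_at (graph_yz \<Omega> u) (graph_point u w) f"
    unfolding f_def normal_form_def by (rule someI_ex[OF normal_form_at_graph_yz[OF u nz w]])
  then obtain U W where UW: "open U" "C2_on U f" "graph_point u w \<in> W"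
      "graph_yz \<Omega> u \<inter> W = (\<lambda>(x, y). (x, y, f (x, y))) ` U"
    unfolding normal_form_at_def by blast
  have "graph_point u w \<in> graph_yz \<Omega> u \<inter> W"
    using UW(3) w by (simp add: graph_yz_def)
  then have r: "r \<in> U" "w = (snd r, f r)"
    unfolding UW(4) r_def graph_point_def by (cases w; auto)+
  have diff: "f differentiable_on U"
    using UW(2) by (simp add: C2_on_def C1_on_def)
  have inv: "\<forall>s\<in>U. (snd s, f s) \<in> \<Omega> \<and> u (snd s, f s) = fst s"
  proof
    fix s assume "s \<in> U"
    then have "(fst s, snd s, f s) \<in> (\<lambda>(x, y). (x, y, f (x, y))) ` U"
      by (intro image_eqI[of _ _ s]) (auto simp: split_beta)
    then have "(fst s, snd s, f s) \<in> graph_yz \<Omega> u"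
      using UW(4) by blast
    then show "(snd s, f s) \<in> \<Omega> \<and> u (snd s, f s) = fst s"
      by (auto simp: graph_yz_def graph_point_def)
  qed
  note 1 = graph_inverse_partials[OF u nz UW(1) diff inv r]
  note 2 = graph_inverse_second_partials[OF u nz UW(1) diff inv r]
  show "pd1 f r = 1 / q" "pd2 f r = - p / q"
    unfolding p_def q_def by (rule has_partials_pd[OF 1]; assumption)+
  show "pd1 (pd1 f) r = - pd2 (pd2 u) w / q ^ 3"
    unfolding q_def by (rule has_partials_pd(1)[OF 2(1)])
  show "pd2 (pd2 f) r = - pd1 (pd1 u) w / q + p * pd1 (pd2 u) w / q\<^sup>2
      + p * pd2 (pd1 u) w / q\<^sup>2 - p\<^sup>2 * pd2 (pd2 u) w / q ^ 3"
    unfolding p_def q_def by (rule has_partials_pd(2)[OF 2(2)])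
qed

text \<open>The squared partial derivatives of the normal form add up to
  \<open>(1 + p^2) / q^2\<close>; the Jacobian factor \<open>\<bar>q\<bar>\<close> cancels one power
  of the denominator.\<close>

lemma rel_area_density_eq:
  assumes u: "C2_on \<Omega> u" "open \<Omega>" and nz: "\<forall>q\<in>\<Omega>. pd2 u q \<noteq> 0"
    and w: "w \<in> \<Omega>"
  shows "rel_area_density \<Omega> u w = (1 + (pd1 u w)\<^sup>2 + (pd2 u w)\<^sup>2) / (2 * \<bar>pd2 u w\<bar>)"
proof -
  have "pd2 u w \<noteq> 0" using nz w by blast
  moreover have "(pd2 u w)\<^sup>2 = \<bar>pd2 u w\<bar> * \<bar>pd2 u w\<bar>" by (simp add: power2_eq_square)
  ultimately show ?thesis
    unfolding rel_area_density_def rel_area_factor_def Let_def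
      normal_form_derivatives(1,2)[OF u nz w]
    by (simp add: field_simps)
qed

text \<open>The degenerate metric ignores z, so the minimum is attained at \<open>(0, y, 0)\<close>,
  as at every point of the plane with the same y.\<close>

lemma iso_dist_set_plane_yz: "iso_dist_set r plane_yz = \<bar>fst r\<bar>"
proof -
  obtain x y z where r: "r = (x, y, z)" by (cases r)
  have "iso_dist r q = sqrt (x\<^sup>2 + (y - fst (snd q))\<^sup>2)" if "q \<in> plane_yz" for q
    using that by (cases q) (auto simp: r iso_dist_def plane_yz_def power2_eq_square)
  then have "(INF q\<in>plane_yz. iso_dist r q) = (INF q\<in>plane_yz. sqrt (x\<^sup>2 + (y - fst (snd q))\<^sup>2))"
    by (intro INF_cong) auto
  also have "\<dots> = \<bar>x\<bar>"
  proof (rule cInf_eq_minimum)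
    show "\<bar>x\<bar> \<in> (\<lambda>q. sqrt (x\<^sup>2 + (y - fst (snd q))\<^sup>2)) ` plane_yz"
      by (rule image_eqI[of _ _ "(0, y, 0)"]) (auto simp: plane_yz_def)
    show "\<bar>x\<bar> \<le> s" if "s \<in> (\<lambda>q. sqrt (x\<^sup>2 + (y - fst (snd q))\<^sup>2)) ` plane_yz" for s
      using that by (auto intro!: real_le_rsqrt)
  qed
  finally show ?thesis by (simp add: iso_dist_set_def r)
qed

section \<open>Extension by zero of functions supported inside an open set\<close>

lemma continuous_on_extend_by_zero:
  fixes h :: "'a::topological_space \<Rightarrow> 'b::real_normed_vector"
  assumes "open S" "open N" "continuous_on S h" "\<And>x. x \<in> S \<inter> N \<Longrightarrow> h x = 0"
  shows "continuous_on (S \<union> N) (\<lambda>x. if x \<in> S then h x else 0)"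
proof (rule continuous_on_open_Un[OF assms(1,2)])
  show "continuous_on S (\<lambda>x. if x \<in> S then h x else 0)"
    using assms(3) by (rule continuous_on_eq) simp
  show "continuous_on N (\<lambda>x. if x \<in> S then h x else 0)"
    by (rule continuous_on_eq[OF continuous_on_const[of N 0]]) (use assms(4) in auto)
qed

text \<open>Every point outside \<open>\<Omega>\<close>, frontier included, has the open
  neighbourhood \<open>- K\<close>, on which the extension is identically 0.\<close>

lemma has_partials_extend_by_zero:
  assumes "open \<Omega>" "closed K" "K \<subseteq> \<Omega>"
    and "\<And>q. q \<in> \<Omega> \<Longrightarrow> has_partials g (a q) (b q) q"
    and "\<And>q. q \<in> \<Omega> - K \<Longrightarrow> g q = 0"
  shows "has_partials (\<lambda>q. if q \<in> \<Omega> then g q else 0)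
    (if q \<in> \<Omega> then a q else 0) (if q \<in> \<Omega> then b q else 0) q"
proof (cases "q \<in> \<Omega>")
  case True
  have "has_partials (\<lambda>q. if q \<in> \<Omega> then g q else 0) (a q) (b q) q"
    by (rule has_partials_cong[OF assms(4)[OF True] assms(1) True]) simp
  with True show ?thesis by simp
next
  case False
  then have "q \<in> - K" using assms(3) by blast
  have "has_partials (\<lambda>q. if q \<in> \<Omega> then g q else 0) 0 0 q"
    by (rule has_partials_cong[OF has_partials_const open_Compl[OF assms(2)] \<open>q \<in> - K\<close>])
      (use assms(5) in auto)
  with False show ?thesis by simp
qed

lemma pd_eq_0_off_support:
  assumes "closed K" "\<forall>q. q \<notin> K \<longrightarrow> g q = 0" "q \<notin> K"
  shows "pd1 g q = 0" "pd2 g q = 0"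
proof -
  have "has_partials g 0 0 q"
    by (rule has_partials_cong[OF has_partials_const open_Compl[OF assms(1)]]) (use assms in auto)
  then show "pd1 g q = 0" "pd2 g q = 0" by (rule has_partials_pd)+
qed

section \<open>Calculus of variations in the plane\<close>

lemma integral_DERIV_eq_0:
  fixes g :: "real \<Rightarrow> real"
  assumes "\<And>s. (g has_real_derivative g' s) (at s)" "g a = 0" "g b = 0"
  shows "integral (cbox a b) g' = 0"
proof (cases "a \<le> b")
  case True
  have "(g' has_integral (g b - g a)) {a..b}"
    by (rule fundamental_theorem_of_calculus[OF True])
      (metis assms(1) has_real_derivative_iff_has_vector_derivative has_vector_derivative_at_within)
  then show ?thesis using assms(2,3) by (simp add: integral_unique)
qed simp

text \<open>Each summand is integrated first in the variable of its own derivative, where the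
  fundamental theorem of calculus leaves only values on the boundary of the box, and these vanish.
  For \<open>P1\<close> this requires swapping the iterated integrals.\<close>

lemma integral_divergence_eq_0:
  assumes P: "\<And>q. has_partials P (P1 q) (P2 q) q" and Q: "\<And>q. has_partials Q (Q1 q) (Q2 q) q"
    and cont: "continuous_on UNIV P1" "continuous_on UNIV Q2"
    and supp: "\<And>q. q \<notin> box A B \<Longrightarrow> P q = 0" "\<And>q. q \<notin> box A B \<Longrightarrow> Q q = 0"
  shows "integral (cbox A B) (\<lambda>q. P1 q + Q2 q) = 0"
proof -
  obtain a c b d where AB: "A = (a, c)" "B = (b, d)" by (cases A, cases B)
  have out: "(a, s) \<notin> box A B" "(b, s) \<notin> box A B" "(s, c) \<notin> box A B" "(s, d) \<notin> box A B" for s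
    by (auto simp: AB box_def Basis_prod_def)
  have c1: "continuous_on (cbox A B) P1" "continuous_on (cbox A B) Q2"
    using cont continuous_on_subset by blast+
  have "integral (cbox A B) P1 = integral (cbox a b) (\<lambda>x. integral (cbox c d) (\<lambda>y. P1 (x, y)))"
    using integral_prod_continuous c1(1) unfolding AB .
  also have "\<dots> = integral (cbox c d) (\<lambda>y. integral (cbox a b) (\<lambda>x. P1 (x, y)))"
    by (rule integral_swap_continuous) (use c1(1) in \<open>simp add: AB split_beta\<close>)
  also have "\<dots> = integral (cbox c d) (\<lambda>y. 0)"
  proof (rule integral_cong)
    fix y
    show "integral (cbox a b) (\<lambda>x. P1 (x, y)) = 0"
      by (rule integral_DERIV_eq_0[of "\<lambda>x. P (x, y)"])
        (use has_partials_fst[OF P[of "(s, y)" for s], simplified] out supp in simp_all)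
  qed
  finally have 1: "integral (cbox A B) P1 = 0" by simp
  have "integral (cbox A B) Q2 = integral (cbox a b) (\<lambda>x. integral (cbox c d) (\<lambda>y. Q2 (x, y)))"
    using integral_prod_continuous c1(2) unfolding AB .
  also have "\<dots> = integral (cbox a b) (\<lambda>x. 0)"
  proof (rule integral_cong)
    fix x
    show "integral (cbox c d) (\<lambda>y. Q2 (x, y)) = 0"
      by (rule integral_DERIV_eq_0[of "\<lambda>y. Q (x, y)"])
        (use has_partials_snd[OF Q[of "(x, s)" for s], simplified] out supp in simp_all)
  qed
  finally have "integral (cbox A B) Q2 = 0" by simp
  with 1 c1 show ?thesis by (simp add: integral_add integrable_continuous)
qed

text \<open>Away from 0 the function is locally zero or a monomial. The exponent is at least 2, so
  at 0 the difference quotient is bounded by \<open>\<bar>h\<bar> ^ Suc n\<close> and tends to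
  0.\<close>

lemma DERIV_max_0_power:
  "((\<lambda>s. max 0 s ^ Suc (Suc n)) has_real_derivative (real (n + 2) * max 0 s ^ Suc n)) (at (s::real))"
proof (cases s "0::real" rule: linorder_cases)
  case less
  have "((\<lambda>s. 0) has_real_derivative 0) (at s)" by simp
  then have "((\<lambda>s. max 0 s ^ Suc (Suc n)) has_real_derivative 0) (at s)"
    by (rule has_field_derivative_transform_within_open[where S = "{..<0}"]) (use less in auto)
  with less show ?thesis by simp
next
  case greater
  have "((\<lambda>s. s ^ Suc (Suc n)) has_real_derivative (real (n + 2) * s ^ Suc n)) (at s)"
    by (rule DERIV_cong[OF DERIV_pow]) simp
  then have "((\<lambda>s. max 0 s ^ Suc (Suc n)) has_real_derivative (real (n + 2) * s ^ Suc n)) (at s)"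
    by (rule has_field_derivative_transform_within_open[where S = "{0<..}"]) (use greater in auto)
  with greater show ?thesis by simp
next
  case equal
  have "((\<lambda>h::real. max 0 h ^ Suc (Suc n) / h) \<longlongrightarrow> 0) (at 0)"
  proof (rule Lim_null_comparison)
    show "\<forall>\<^sub>F h in at 0. norm (max 0 h ^ Suc (Suc n) / h) \<le> \<bar>h\<bar> ^ Suc n"
    proof (intro always_eventually allI)
      fix h :: real
      show "norm (max 0 h ^ Suc (Suc n) / h) \<le> \<bar>h\<bar> ^ Suc n"
      proof (cases "h > 0")
        case False
        then have "max 0 h ^ Suc (Suc n) = 0" by simp
        then show ?thesis by (simp only: div_0 norm_zero zero_le_power abs_ge_zero)
      qed simp
    qed
    have "((\<lambda>h::real. \<bar>h\<bar> ^ Suc n) \<longlongrightarrow> \<bar>0\<bar> ^ Suc n) (at 0)"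
      by (intro tendsto_intros)
    then show "((\<lambda>h::real. \<bar>h\<bar> ^ Suc n) \<longlongrightarrow> 0) (at 0)" by simp
  qed
  with equal show ?thesis by (simp add: DERIV_def)
qed

lemma has_partials_compose_real:
  assumes "(b has_real_derivative D) (at (g q))" "has_partials g \<alpha> \<beta> q"
  shows "has_partials (\<lambda>q. b (g q)) (D * \<alpha>) (D * \<beta>) q"
  using has_derivative_compose[OF assms(2), of b "(*) D"] assms(1)
  by (auto simp: has_field_derivative_def algebra_simps elim!: has_derivative_eq_rhs)

lemma C2_on_UNIV_I:
  assumes "\<And>q. has_partials f (a q) (b q) q" "C1_on UNIV a" "C1_on UNIV b"
  shows "C2_on UNIV f"
proof -
  have "pd1 f = a" "pd2 f = b" using has_partials_pd[OF assms(1)] by (auto intro!: ext)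
  moreover have "C1_on UNIV f"
    by (rule C1_onI[OF open_UNIV assms(1)])
      (use assms C1_on_has_partials has_partials_continuous_on open_UNIV in blast)+
  ultimately show ?thesis using assms unfolding C2_on_def by simp
qed

text \<open>The bump is a power of the positive part of \<open>r^2\<close> minus the squared
  distance to \<open>z\<close>. The cube is the lowest power that is C2, the class demanded of a
  variation field.\<close>

lemma exists_bump_variation_field:
  fixes z :: point2
  assumes r: "r > 0" "cball z r \<subseteq> \<Omega>"
  obtains \<phi> where "variation_field \<Omega> \<phi>" "\<And>q. q \<notin> cball z r \<Longrightarrow> \<phi> q = 0"
    "\<And>q. \<phi> q \<ge> 0" "\<phi> z > 0"
proof -
  define \<rho> where "\<rho> = (\<lambda>q :: point2. r\<^sup>2 - (fst q - fst z)\<^sup>2 - (snd q - snd z)\<^sup>2)"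
  have \<rho>: "has_partials \<rho> (- 2 * (fst q - fst z)) (- 2 * (snd q - snd z)) q" for q
    unfolding \<rho>_def by (auto intro!: derivative_eq_intros simp: algebra_simps)
  have [continuous_intros]: "continuous_on S \<rho>" for S
    unfolding \<rho>_def by (intro continuous_intros)
  define b where "b = (\<lambda>n q. max 0 (\<rho> q) ^ n)"
  have b: "has_partials (b (Suc (Suc n))) (real (n + 2) * b (Suc n) q * (- 2 * (fst q - fst z)))
      (real (n + 2) * b (Suc n) q * (- 2 * (snd q - snd z))) q" for n q
    unfolding b_def by (rule has_partials_compose_real[OF DERIV_max_0_power \<rho>])
  have [continuous_intros]: "continuous_on S (b n)" for S n
    unfolding b_def by (intro continuous_intros)
  define \<phi> where "\<phi> = b 3"
  have \<phi>: "\<phi> q = max 0 (r\<^sup>2 - (fst q - fst z)\<^sup>2 - (snd q - snd z)\<^sup>2) ^ 3" for q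
    by (simp add: \<phi>_def b_def \<rho>_def)
  have lin: "has_partials (\<lambda>q. - 2 * (fst q - fst z)) (- 2) 0 q"
      "has_partials (\<lambda>q. - 2 * (snd q - snd z)) 0 (- 2) q" for q
    by (auto intro!: derivative_eq_intros)
  have "C2_on UNIV (b 3)"
  proof (rule C2_on_UNIV_I)
    show "has_partials (b 3) (3 * (b 2 q * (- 2 * (fst q - fst z))))
        (3 * (b 2 q * (- 2 * (snd q - snd z)))) q" for q
      using b[of 1 q] by (simp add: numeral_eq_Suc mult.assoc)
    note b2 = b[of 0, unfolded One_nat_def[symmetric] add_0 Suc_1]
    show "C1_on UNIV (\<lambda>q. 3 * (b 2 q * (- 2 * (fst q - fst z))))"
      by (rule C1_onI[OF open_UNIV has_partials_mult[OF has_partials_const has_partials_mult[OF b2 lin(1)]]];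
        intro continuous_intros)
    show "C1_on UNIV (\<lambda>q. 3 * (b 2 q * (- 2 * (snd q - snd z))))"
      by (rule C1_onI[OF open_UNIV has_partials_mult[OF has_partials_const has_partials_mult[OF b2 lin(2)]]];
        intro continuous_intros)
  qed
  then have C2: "C2_on UNIV \<phi>" by (simp add: \<phi>_def)
  have supp: "\<phi> q = 0" if "q \<notin> cball z r" for q
  proof -
    have "r < dist z q" using that by simp
    then have "r\<^sup>2 < (dist z q)\<^sup>2" using r(1) by (intro power_strict_mono) auto
    also have "(dist z q)\<^sup>2 = (fst q - fst z)\<^sup>2 + (snd q - snd z)\<^sup>2"
      by (cases z, cases q) (simp add: dist_Pair_Pair dist_real_def power2_commute)
    finally show ?thesis by (simp add: \<phi>)
  qed
  have var: "variation_field \<Omega> \<phi>"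
    unfolding variation_field_def
    using C2 supp r(2) by (intro conjI exI[of _ "cball z r"]) auto
  show ?thesis
    by (rule that[OF var supp]) (use r(1) in \<open>simp_all add: \<phi>\<close>)
qed

text \<open>A bump supported where \<open>E\<close> keeps the sign it has at \<open>z\<close> makes
  the integrand of one sign; being continuous on the box with integral 0, it vanishes, also at
  \<open>z\<close>, where the bump is positive.\<close>

lemma fundamental_lemma_calculus_of_variations:
  assumes \<Omega>: "open \<Omega>" "\<Omega> \<subseteq> box A B" and E: "continuous_on \<Omega> E"
    and int: "\<And>\<phi>. variation_field \<Omega> \<phi> \<Longrightarrow>
      integral (cbox A B) (\<lambda>q. if q \<in> \<Omega> then E q * \<phi> q else 0) = 0"
    and z: "z \<in> \<Omega>"
  shows "E z = 0"
proof (rule ccontr)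
  assume "E z \<noteq> 0"
  define s where "s = sgn (E z)"
  have "continuous_on \<Omega> (\<lambda>q. s * E q)" by (intro continuous_intros E)
  then have "open (\<Omega> \<inter> (\<lambda>q. s * E q) -` {0<..})"
    using \<Omega>(1) open_greaterThan by (rule continuous_open_preimage)
  moreover have "s * E z = \<bar>E z\<bar>" unfolding s_def by (metis abs_sgn mult.commute)
  with z \<open>E z \<noteq> 0\<close> have "z \<in> \<Omega> \<inter> (\<lambda>q. s * E q) -` {0<..}" by simp
  ultimately obtain r where r: "r > 0" "cball z r \<subseteq> \<Omega> \<inter> (\<lambda>q. s * E q) -` {0<..}"
    by (meson open_contains_cball)
  have "cball z r \<subseteq> \<Omega>" using r(2) by blast
  then obtain \<phi> where bump: "variation_field \<Omega> \<phi>" "\<And>q. q \<notin> cball z r \<Longrightarrow> \<phi> q = 0"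
    "\<And>q. \<phi> q \<ge> 0" "\<phi> z > 0"
    using exists_bump_variation_field[OF r(1)] by metis
  define g where "g = (\<lambda>q. if q \<in> \<Omega> then E q * \<phi> q else 0)"
  have "continuous_on UNIV \<phi>"
    using bump(1) C2_on_continuous(1) open_UNIV unfolding variation_field_def by blast
  then have "continuous_on \<Omega> (\<lambda>q. E q * \<phi> q)"
    by (intro continuous_intros E) (blast intro: continuous_on_subset)
  then have "continuous_on (\<Omega> \<union> - cball z r) g"
    unfolding g_def
    by (rule continuous_on_extend_by_zero[OF \<Omega>(1) open_Compl[OF closed_cball]]) (use bump(2) in auto)
  moreover have "\<Omega> \<union> - cball z r = UNIV" using r(2) by blast
  ultimately have g: "continuous_on (cbox A B) (\<lambda>q. s * g q)"
    using continuous_on_subset by (intro continuous_intros) blast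
  have "s * g z = 0"
  proof (rule has_integral_0_cbox_imp_0[OF g])
    show "0 \<le> s * g q" for q
    proof (cases "q \<in> cball z r")
      case True
      then have "0 < s * E q" "q \<in> \<Omega>" using r(2) by auto
      then show ?thesis using bump(3)[of q] by (simp add: g_def flip: mult.assoc)
    qed (use bump(2) in \<open>simp add: g_def\<close>)
    have "integral (cbox A B) (\<lambda>q. s * g q) = 0"
      using int[OF bump(1)] by (simp add: g_def)
    then show "((\<lambda>q. s * g q) has_integral 0) (cbox A B)"
      using integrable_continuous[OF g] by (simp add: has_integral_iff)
    show "box A B \<noteq> {}" "z \<in> cbox A B" using z \<Omega>(2) box_subset_cbox by blast+
  qed
  moreover have "s * E z > 0" using subsetD[OF r(2), of z] r(1) by simp
  ultimately show False using bump(4) z by (auto simp: g_def)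
qed

text \<open>\<open>F\<close> may be unbounded near the frontier, and integrability of
  \<open>G\<close> is not assumed. Their difference vanishes off \<open>K\<close>, so its extension
  by zero is continuous, and its Lebesgue integral becomes a Henstock-Kurzweil integral over a box,
  the form in which Leibniz's rule is applied.\<close>

lemma set_integral_perturb:
  fixes F G :: "'a::euclidean_space \<Rightarrow> real"
  assumes \<Omega>: "open \<Omega>" "\<Omega> \<subseteq> cbox A B" and K: "closed K" "K \<subseteq> \<Omega>"
    and F: "set_integrable lborel \<Omega> F" and cont: "continuous_on \<Omega> F" "continuous_on \<Omega> G"
    and eq: "\<And>q. q \<in> \<Omega> - K \<Longrightarrow> G q = F q"
  defines "e \<equiv> \<lambda>q. if q \<in> \<Omega> then G q - F q else 0"
  shows "continuous_on UNIV e"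
    and "(LINT q:\<Omega>|lborel. G q) = (LINT q:\<Omega>|lborel. F q) + integral (cbox A B) e"
proof -
  have "continuous_on (\<Omega> \<union> - K) e"
    unfolding e_def
    by (rule continuous_on_extend_by_zero[OF \<Omega>(1) open_Compl[OF K(1)]])
      (use eq in \<open>auto intro!: continuous_intros cont\<close>)
  moreover have "\<Omega> \<union> - K = UNIV" using K by blast
  ultimately show e: "continuous_on UNIV e" by simp
  have "set_integrable lborel (cbox A B) e"
    unfolding set_integrable_def
    by (intro borel_integrable_compact compact_cbox continuous_on_subset[OF e]) simp
  moreover have ind: "indicator (cbox A B) q *\<^sub>R e q = indicator \<Omega> q *\<^sub>R (G q - F q)" for q
    using \<Omega>(2) by (auto simp: e_def indicator_def)
  ultimately have "set_integrable lborel \<Omega> (\<lambda>q. G q - F q)"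
    and "(LINT q:\<Omega>|lborel. G q - F q) = integral (cbox A B) e"
    using set_borel_integral_eq_integral(2)[of "cbox A B" e]
    unfolding set_integrable_def set_lebesgue_integral_def by (simp_all only: ind)
  then show "(LINT q:\<Omega>|lborel. G q) = (LINT q:\<Omega>|lborel. F q) + integral (cbox A B) e"
    using set_integral_add(2)[OF F, of "\<lambda>q. G q - F q"] by simp
qed

text \<open>Serves the moment integrand, the bounded function \<open>u\<close> times the merely
  integrable area density.\<close>

lemma set_integrable_mult_bounded:
  fixes f g :: "'a::euclidean_space \<Rightarrow> real"
  assumes "open \<Omega>" "continuous_on \<Omega> f" "continuous_on \<Omega> g"
    and g: "set_integrable lborel \<Omega> g" and bdd: "\<And>q. q \<in> \<Omega> \<Longrightarrow> \<bar>f q\<bar> \<le> C"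
  shows "set_integrable lborel \<Omega> (\<lambda>q. f q * g q)"
  unfolding set_integrable_def
proof (rule Bochner_Integration.integrable_bound)
  show "integrable lborel (\<lambda>q. C * (indicator \<Omega> q *\<^sub>R g q))"
    using g unfolding set_integrable_def by (rule integrable_mult_right)
  have "(\<lambda>q. indicator \<Omega> q *\<^sub>R (f q * g q)) \<in> borel_measurable borel"
    using assms(1) by (intro borel_measurable_continuous_on_indicator continuous_intros assms(2,3)) simp
  then show "(\<lambda>q. indicator \<Omega> q *\<^sub>R (f q * g q)) \<in> borel_measurable lborel" by simp
  show "AE q in lborel. norm (indicator \<Omega> q *\<^sub>R (f q * g q)) \<le> norm (C * (indicator \<Omega> q *\<^sub>R g q))"
  proof (rule AE_I2)
    fix q
    show "norm (indicator \<Omega> q *\<^sub>R (f q * g q)) \<le> norm (C * (indicator \<Omega> q *\<^sub>R g q))"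
    proof (cases "q \<in> \<Omega>")
      case True
      then have "\<bar>f q\<bar> \<le> \<bar>C\<bar>" using bdd[OF True] by linarith
      then show ?thesis using True by (simp add: abs_mult mult_right_mono)
    qed simp
  qed
qed

lemma variation_partials:
  assumes u: "C2_on \<Omega> u" "open \<Omega>" and \<phi>: "C2_on UNIV \<phi>"
  shows "C2_on \<Omega> (\<lambda>q. u q + t * \<phi> q)"
    and "\<And>q. q \<in> \<Omega> \<Longrightarrow> pd1 (\<lambda>q. u q + t * \<phi> q) q = pd1 u q + t * pd1 \<phi> q"
    and "\<And>q. q \<in> \<Omega> \<Longrightarrow> pd2 (\<lambda>q. u q + t * \<phi> q) q = pd2 u q + t * pd2 \<phi> q"
proof -
  let ?w = "\<lambda>q. u q + t * \<phi> q"
  have sum: "has_partials (\<lambda>q. g q + t * h q) (a + t * c) (b + t * d) q"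
    if "has_partials g a b q" "has_partials h c d q" for g h a b c d q
    using has_partials_add[OF that(1) has_partials_mult[OF has_partials_const[of t] that(2)]] by simp
  note up = C2_on_has_partials[OF u]
  note \<phi>p = C2_on_has_partials[OF \<phi> open_UNIV UNIV_I]
  have cont: "continuous_on \<Omega> (\<lambda>q. g q + t * h q)"
    if "continuous_on \<Omega> g" "continuous_on UNIV h" for g h :: "point2 \<Rightarrow> real"
    by (intro continuous_intros that continuous_on_subset[OF that(2)]) simp
  note conts = C2_on_continuous[OF u] C2_on_continuous[OF \<phi> open_UNIV]
  have w: "has_partials ?w (pd1 u q + t * pd1 \<phi> q) (pd2 u q + t * pd2 \<phi> q) q" if "q \<in> \<Omega>" for q
    using sum[OF up(1)[OF that] \<phi>p(1)] .
  note pd = has_partials_pd[OF w]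
  then show "\<And>q. q \<in> \<Omega> \<Longrightarrow> pd1 ?w q = pd1 u q + t * pd1 \<phi> q"
    "\<And>q. q \<in> \<Omega> \<Longrightarrow> pd2 ?w q = pd2 u q + t * pd2 \<phi> q" by blast+
  have w1: "has_partials (pd1 ?w) (pd1 (pd1 u) q + t * pd1 (pd1 \<phi>) q)
      (pd2 (pd1 u) q + t * pd2 (pd1 \<phi>) q) q" if "q \<in> \<Omega>" for q
    by (rule has_partials_cong[OF sum[OF up(2)[OF that] \<phi>p(2)] u(2) that]) (simp add: pd)
  have w2: "has_partials (pd2 ?w) (pd1 (pd2 u) q + t * pd1 (pd2 \<phi>) q)
      (pd2 (pd2 u) q + t * pd2 (pd2 \<phi>) q) q" if "q \<in> \<Omega>" for q
    by (rule has_partials_cong[OF sum[OF up(3)[OF that] \<phi>p(3)] u(2) that]) (simp add: pd)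
  show "C2_on \<Omega> ?w"
    unfolding C2_on_def
    by (intro conjI C1_onI[OF u(2) w] C1_onI[OF u(2) w1] C1_onI[OF u(2) w2] cont conts)
qed

text \<open>\<open>pd2 u\<close> may tend to 0 at the frontier, so a uniform bound comes from the
  compact set \<open>K\<close> alone; off \<open>K\<close> the variation is locally zero and changes
  nothing.\<close>

lemma variation_stays_admissible:
  fixes \<sigma> :: real
  assumes u: "C2_on \<Omega> u" "open \<Omega>" and pos: "\<forall>q\<in>\<Omega>. \<sigma> * pd2 u q > 0"
    and \<phi>: "C2_on UNIV \<phi>" and K: "compact K" "K \<subseteq> \<Omega>" "\<forall>q. q \<notin> K \<longrightarrow> \<phi> q = 0"
  obtains \<epsilon> where "\<epsilon> > 0"
    "\<And>t q. t \<in> {-\<epsilon><..<\<epsilon>} \<Longrightarrow> q \<in> \<Omega> \<Longrightarrow> \<sigma> * (pd2 u q + t * pd2 \<phi> q) > 0"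
proof -
  \<comment> \<open>With this ratio the claim on \<open>K\<close> factors through
    \<open>1 + t * g q > 0\<close>, so \<open>1 / C\<close> can serve as \<open>\<epsilon>\<close>
    once \<open>C\<close> bounds the ratio.\<close>
  define g where "g = (\<lambda>q. \<sigma> * pd2 \<phi> q / (\<sigma> * pd2 u q))"
  have "\<forall>q\<in>K. \<sigma> * pd2 u q \<noteq> 0" using pos K(2) by (metis less_irrefl subsetD)
  then have "continuous_on K g"
    unfolding g_def
    by (intro continuous_intros continuous_on_subset[OF C2_on_continuous(3)[OF \<phi> open_UNIV]]
        continuous_on_subset[OF C2_on_continuous(3)[OF u] K(2)]) simp_all
  then have "bounded (g ` K)"
    using K(1) compact_continuous_image compact_imp_bounded by blast
  then obtain C where C: "C > 0" "\<And>q. q \<in> K \<Longrightarrow> \<bar>g q\<bar> \<le> C"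
    by (auto simp: bounded_pos)
  have "\<sigma> * (pd2 u q + t * pd2 \<phi> q) > 0" if t: "t \<in> {-(1 / C)<..<1 / C}" and q: "q \<in> \<Omega>" for t q
  proof (cases "q \<in> K")
    case True
    have s: "\<sigma> * pd2 u q > 0" using pos q by blast
    have "\<bar>t\<bar> < 1 / C" using t by auto
    then have "\<bar>t\<bar> * C < 1" using C(1) by (simp add: field_simps)
    moreover have "\<bar>t * g q\<bar> \<le> \<bar>t\<bar> * C"
      unfolding abs_mult using C(2)[OF True] by (intro mult_left_mono) auto
    ultimately have "1 + t * g q > 0" by linarith
    with s have "(\<sigma> * pd2 u q) * (1 + t * g q) > 0" by (rule mult_pos_pos)
    also have "(\<sigma> * pd2 u q) * (1 + t * g q) = \<sigma> * (pd2 u q + t * pd2 \<phi> q)"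
      using s by (auto simp: g_def field_simps)
    finally show ?thesis .
  next
    case False
    then have "pd2 \<phi> q = 0" by (rule pd_eq_0_off_support(2)[OF compact_imp_closed[OF K(1)] K(3)])
    with pos q show ?thesis by simp
  qed
  with C(1) show ?thesis using that[of "1 / C"] by simp
qed

section \<open>First variation of the energy\<close>

context
  fixes \<Omega> :: "point2 set" and u :: "point2 \<Rightarrow> real" and \<sigma> lam :: real and A B :: point2
  assumes op: "open \<Omega>" and sub: "\<Omega> \<subseteq> box A B" and u: "C2_on \<Omega> u"
    and bdd: "bounded (u ` \<Omega>)"
    and \<sigma>: "\<bar>\<sigma>\<bar> = 1" and pos: "\<forall>q\<in>\<Omega>. \<sigma> * pd2 u q > 0"
    and area: "set_integrable lborel \<Omega> (rel_area_density \<Omega> u)"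
begin

text \<open>This is \<open>L_u - (L_p)_y - (L_q)_z\<close> for the Lagrangian
  \<open>L = \<sigma> (u - lam) (1 + p^2 + q^2) / (2 q)\<close>. The terms free of second
  derivatives collapse to \<open>1 / q\<close>, and the bracket multiplied by \<open>u - lam\<close>
  is \<open>- 2 H\<close>.\<close>

definition euler_lagrange :: "point2 \<Rightarrow> real"
  where "euler_lagrange w = (let p = pd1 u w; q = pd2 u w in
    \<sigma> * (1 / q - (u w - lam) * (pd1 (pd1 u) w / q - p * pd1 (pd2 u) w / q\<^sup>2
      - p * pd2 (pd1 u) w / q\<^sup>2 + (1 + p\<^sup>2) * pd2 (pd2 u) w / q ^ 3)))"

text \<open>The derivative of the same Lagrangian in the direction \<open>\<phi>\<close>, that is,
  \<open>L_u\<close> times \<open>\<phi>\<close> plus \<open>L_p\<close> and \<open>L_q\<close>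
  times the partials of \<open>\<phi>\<close>.\<close>

definition first_variation :: "(point2 \<Rightarrow> real) \<Rightarrow> point2 \<Rightarrow> real"
  where "first_variation \<phi> w = (let p = pd1 u w; q = pd2 u w in
    \<sigma> * (\<phi> w * (1 + p\<^sup>2 + q\<^sup>2) / (2 * q) + (u w - lam) *
      (p / q * pd1 \<phi> w + (1 - (1 + p\<^sup>2) / q\<^sup>2) / 2 * pd2 \<phi> w)))"

text \<open>Integration by parts: pointwise the two integrands differ by \<open>\<sigma>\<close>
  times the divergence \<open>D\<close> of the field \<open>(P \<phi>, Q \<phi>)\<close>, which
  vanishes off \<open>K\<close> and so extends by zero to the box.\<close>

lemma integral_first_variation:
  assumes \<phi>: "variation_field \<Omega> \<phi>"
  shows "integral (cbox A B) (\<lambda>q. if q \<in> \<Omega> then first_variation \<phi> q else 0)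
    = integral (cbox A B) (\<lambda>q. if q \<in> \<Omega> then euler_lagrange q * \<phi> q else 0)"
proof -
  from \<phi> obtain K where \<phi>2: "C2_on UNIV \<phi>" and K: "compact K" "K \<subseteq> \<Omega>" "\<forall>q. q \<notin> K \<longrightarrow> \<phi> q = 0"
    unfolding variation_field_def by blast
  note clK = compact_imp_closed[OF K(1)]
  have K0: "\<phi> q = 0" if "q \<notin> K" for q using K(3) that by blast
  have nz: "pd2 u q \<noteq> 0" if "q \<in> \<Omega>" for q using pos that by force
  note up = C2_on_has_partials[OF u op]
  note \<phi>p = C2_on_has_partials(1)[OF \<phi>2 open_UNIV UNIV_I]
  note van = pd_eq_0_off_support[OF clK K(3)]
  note conts = C2_on_continuous[OF u op] C2_on_continuous[OF \<phi>2 open_UNIV, THEN continuous_on_subset, OF subset_UNIV]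
  have ext0: "continuous_on UNIV (\<lambda>q. if q \<in> \<Omega> then h q else 0)"
    if "continuous_on \<Omega> h" "\<And>q. q \<in> \<Omega> - K \<Longrightarrow> h q = 0" for h :: "point2 \<Rightarrow> real"
  proof -
    have "continuous_on (\<Omega> \<union> - K) (\<lambda>q. if q \<in> \<Omega> then h q else 0)"
      by (rule continuous_on_extend_by_zero[OF op open_Compl[OF clK] that(1)]) (use that(2) in auto)
    moreover have "\<Omega> \<union> - K = UNIV" using K(2) by blast
    ultimately show ?thesis by simp
  qed
  \<comment> \<open>\<open>\<sigma> P\<close> and \<open>\<sigma> Q\<close> below are the derivatives of the Lagrangian in \<open>p\<close> and \<open>q\<close>.\<close>
  define v where "v = (\<lambda>w. u w + - lam)"
  define i where "i = (\<lambda>w. 1 / pd2 u w)"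
  define j1 where "j1 = (\<lambda>w. - pd1 (pd2 u) w / (pd2 u w)\<^sup>2)"
  define j2 where "j2 = (\<lambda>w. - pd2 (pd2 u) w / (pd2 u w)\<^sup>2)"
  have vp: "has_partials v (pd1 u w) (pd2 u w) w" if "w \<in> \<Omega>" for w
    using has_partials_add[OF up(1)[OF that] has_partials_const[of "- lam"]] unfolding v_def by simp
  have ip: "has_partials i (j1 w) (j2 w) w" if "w \<in> \<Omega>" for w
    unfolding i_def j1_def j2_def by (rule has_partials_inverse[OF up(3)[OF that] nz[OF that]])
  have cv: "continuous_on \<Omega> v" unfolding v_def by (intro continuous_intros conts)
  have ci: "continuous_on \<Omega> i" unfolding i_def by (intro continuous_intros conts) (use nz in auto)
  have cj: "continuous_on \<Omega> j1" "continuous_on \<Omega> j2"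
    unfolding j1_def j2_def by (intro continuous_intros conts; use nz in auto)+
  note conts' = conts cv ci cj
  define P where "P = (\<lambda>w. v w * (pd1 u w * i w))"
  define P1 where "P1 = (\<lambda>w. pd1 u w * (pd1 u w * i w) + v w * (pd1 (pd1 u) w * i w + pd1 u w * j1 w))"
  define P2 where "P2 = (\<lambda>w. pd2 u w * (pd1 u w * i w) + v w * (pd2 (pd1 u) w * i w + pd1 u w * j2 w))"
  have P: "has_partials P (P1 w) (P2 w) w" if "w \<in> \<Omega>" for w
    unfolding P_def P1_def P2_def by (intro has_partials_mult vp up(2) ip that)
  define R where "R = (\<lambda>w. 1 + pd1 u w * pd1 u w)"
  define R1 where "R1 = (\<lambda>w. 0 + (pd1 (pd1 u) w * pd1 u w + pd1 u w * pd1 (pd1 u) w))"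
  define R2 where "R2 = (\<lambda>w. 0 + (pd2 (pd1 u) w * pd1 u w + pd1 u w * pd2 (pd1 u) w))"
  have R: "has_partials R (R1 w) (R2 w) w" if "w \<in> \<Omega>" for w
    unfolding R_def R1_def R2_def by (intro has_partials_mult has_partials_add has_partials_const up(2) that)
  define Q where "Q = (\<lambda>w. v w * (1 / 2 + - (1 / 2) * (R w * (i w * i w))))"
  \<comment> \<open>The summand \<open>0\<close> and the product with \<open>0\<close> are
    derivatives of constants, kept so that the sum and product rules yield this expression
    verbatim.\<close>
  define Q1 where "Q1 = (\<lambda>w. pd1 u w * (1 / 2 + - (1 / 2) * (R w * (i w * i w))) + v w *
    (0 + (0 * (R w * (i w * i w)) + - (1 / 2) * (R1 w * (i w * i w) + R w * (j1 w * i w + i w * j1 w)))))"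
  define Q2 where "Q2 = (\<lambda>w. pd2 u w * (1 / 2 + - (1 / 2) * (R w * (i w * i w))) + v w *
    (0 + (0 * (R w * (i w * i w)) + - (1 / 2) * (R2 w * (i w * i w) + R w * (j2 w * i w + i w * j2 w)))))"
  have Q: "has_partials Q (Q1 w) (Q2 w) w" if "w \<in> \<Omega>" for w
    unfolding Q_def Q1_def Q2_def
    by (intro has_partials_mult has_partials_add has_partials_const vp R ip that)
  define D where "D = (\<lambda>w. (P1 w * \<phi> w + P w * pd1 \<phi> w) + (Q2 w * \<phi> w + Q w * pd2 \<phi> w))"
  have D: "integral (cbox A B) (\<lambda>w. if w \<in> \<Omega> then D w else 0) = 0"
  proof -
    have "integral (cbox A B) (\<lambda>w. (if w \<in> \<Omega> then P1 w * \<phi> w + P w * pd1 \<phi> w else 0)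
        + (if w \<in> \<Omega> then Q2 w * \<phi> w + Q w * pd2 \<phi> w else 0)) = 0"
    proof (rule integral_divergence_eq_0)
      show "has_partials (\<lambda>w. if w \<in> \<Omega> then P w * \<phi> w else 0)
          (if w \<in> \<Omega> then P1 w * \<phi> w + P w * pd1 \<phi> w else 0)
          (if w \<in> \<Omega> then P2 w * \<phi> w + P w * pd2 \<phi> w else 0) w" for w
      proof (rule has_partials_extend_by_zero[OF op clK K(2)])
        show "has_partials (\<lambda>w. P w * \<phi> w) (P1 w * \<phi> w + P w * pd1 \<phi> w)
            (P2 w * \<phi> w + P w * pd2 \<phi> w) w" if "w \<in> \<Omega>" for w
          by (rule has_partials_mult[OF P[OF that] \<phi>p])
        show "P w * \<phi> w = 0" if "w \<in> \<Omega> - K" for w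
          using that by (simp add: K0)
      qed
      show "has_partials (\<lambda>w. if w \<in> \<Omega> then Q w * \<phi> w else 0)
          (if w \<in> \<Omega> then Q1 w * \<phi> w + Q w * pd1 \<phi> w else 0)
          (if w \<in> \<Omega> then Q2 w * \<phi> w + Q w * pd2 \<phi> w else 0) w" for w
      proof (rule has_partials_extend_by_zero[OF op clK K(2)])
        show "has_partials (\<lambda>w. Q w * \<phi> w) (Q1 w * \<phi> w + Q w * pd1 \<phi> w)
            (Q2 w * \<phi> w + Q w * pd2 \<phi> w) w" if "w \<in> \<Omega>" for w
          by (rule has_partials_mult[OF Q[OF that] \<phi>p])
        show "Q w * \<phi> w = 0" if "w \<in> \<Omega> - K" for w
          using that by (simp add: K0)
      qed
      show "continuous_on UNIV (\<lambda>w. if w \<in> \<Omega> then P1 w * \<phi> w + P w * pd1 \<phi> w else 0)"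
        unfolding P1_def P_def
        by (rule ext0, intro continuous_intros conts') (use K0 van in auto)
      show "continuous_on UNIV (\<lambda>w. if w \<in> \<Omega> then Q2 w * \<phi> w + Q w * pd2 \<phi> w else 0)"
        unfolding Q2_def Q_def R_def R2_def
        by (rule ext0, intro continuous_intros conts') (use K0 van in auto)
      show "(if w \<in> \<Omega> then P w * \<phi> w else 0) = 0" "(if w \<in> \<Omega> then Q w * \<phi> w else 0) = 0"
        if "w \<notin> box A B" for w using that sub by auto
    qed
    moreover have "(\<lambda>w. if w \<in> \<Omega> then D w else 0) = (\<lambda>w.
        (if w \<in> \<Omega> then P1 w * \<phi> w + P w * pd1 \<phi> w else 0)
        + (if w \<in> \<Omega> then Q2 w * \<phi> w + Q w * pd2 \<phi> w else 0))"
      by (simp add: fun_eq_iff D_def)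
    ultimately show ?thesis by simp
  qed
  have eq: "first_variation \<phi> w = euler_lagrange w * \<phi> w + \<sigma> * D w" if "w \<in> \<Omega>" for w
  proof -
    define p q a b c d where "p = pd1 u w" and "q = pd2 u w" and "a = pd1 (pd1 u) w"
      and "b = pd2 (pd1 u) w" and "c = pd1 (pd2 u) w" and "d = pd2 (pd2 u) w"
    note defs = p_def q_def a_def b_def c_def d_def
    have "q \<noteq> 0" using nz[OF that] by (simp add: q_def)
    \<comment> \<open>With \<open>k\<close> in place of \<open>1 / q\<close> the identity becomes
      polynomial modulo \<open>k * q = 1\<close>, which is the setting of
      \<open>algebra\<close>.\<close>
    define k where "k = inverse q"
    have iq: "k * q = 1" using \<open>q \<noteq> 0\<close> by (simp add: k_def)
    have dv: "x / q = x * k" "x / q\<^sup>2 = x * k\<^sup>2" "x / q ^ 3 = x * k ^ 3" "x / (2 * q) = x * k * (1 / 2)" for x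
      using \<open>q \<noteq> 0\<close> by (simp_all add: k_def field_simps)
    show ?thesis
      unfolding first_variation_def euler_lagrange_def Let_def D_def P1_def Q2_def P_def Q_def
        R_def R2_def i_def j1_def j2_def v_def
      unfolding defs[symmetric]
      unfolding dv using iq by algebra
  qed
  have cE: "continuous_on \<Omega> euler_lagrange"
    unfolding euler_lagrange_def Let_def by (intro continuous_intros conts) (use nz in auto)
  let ?E = "\<lambda>w. if w \<in> \<Omega> then euler_lagrange w * \<phi> w else 0"
  let ?D = "\<lambda>w. if w \<in> \<Omega> then D w else 0"
  have c: "continuous_on UNIV ?E" "continuous_on UNIV ?D"
    unfolding D_def P1_def P_def Q2_def Q_def R_def R2_def
    by (rule ext0, intro continuous_intros conts' cE; use K0 van in auto)+
  have "integral (cbox A B) (\<lambda>w. if w \<in> \<Omega> then first_variation \<phi> w else 0)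
      = integral (cbox A B) (\<lambda>w. ?E w + \<sigma> * ?D w)"
    by (rule integral_cong) (simp add: eq)
  also have "\<dots> = integral (cbox A B) ?E + integral (cbox A B) (\<lambda>w. \<sigma> * ?D w)"
    by (intro integral_add integrable_continuous continuous_intros continuous_on_subset[OF c(1)]
        continuous_on_subset[OF c(2)]) auto
  also have "\<dots> = integral (cbox A B) ?E" using D by simp
  finally show ?thesis .
qed

lemma energy_has_derivative:
  assumes \<phi>: "variation_field \<Omega> \<phi>"
  shows "((\<lambda>t. energy_yz \<Omega> lam (\<lambda>q. u q + t * \<phi> q)) has_real_derivative
    integral (cbox A B) (\<lambda>q. if q \<in> \<Omega> then first_variation \<phi> q else 0)) (at 0)"
proof -
  from \<phi> obtain K where \<phi>2: "C2_on UNIV \<phi>" and K: "compact K" "K \<subseteq> \<Omega>" "\<forall>q. q \<notin> K \<longrightarrow> \<phi> q = 0"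
    unfolding variation_field_def by blast
  note clK = compact_imp_closed[OF K(1)]
  have K0: "\<phi> q = 0" if "q \<notin> K" for q using K(3) that by blast
  note van = pd_eq_0_off_support[OF clK K(3)]
  note conts = C2_on_continuous[OF u op] C2_on_continuous[OF \<phi>2 open_UNIV, THEN continuous_on_subset, OF subset_UNIV]
  obtain \<epsilon> where \<epsilon>: "\<epsilon> > 0"
    "\<And>t q. t \<in> {-\<epsilon><..<\<epsilon>} \<Longrightarrow> q \<in> \<Omega> \<Longrightarrow> \<sigma> * (pd2 u q + t * pd2 \<phi> q) > 0"
    using variation_stays_admissible[OF u op pos \<phi>2 K] by metis
  define T where "T = {-\<epsilon><..<\<epsilon>}"
  have T: "open T" "convex T" "0 \<in> T" using \<epsilon>(1) by (auto simp: T_def)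
  define p where "p = (\<lambda>t q. pd1 u q + t * pd1 \<phi> q)"
  define r where "r = (\<lambda>t q. pd2 u q + t * pd2 \<phi> q)"
  define w where "w = (\<lambda>t q. u q + t * \<phi> q)"
  have r: "\<sigma> * r t q > 0" if "t \<in> T" "q \<in> \<Omega>" for t q
    unfolding r_def using \<epsilon>(2) that unfolding T_def by blast
  have rnz: "r t q \<noteq> 0" if "t \<in> T" "q \<in> \<Omega>" for t q using r[OF that] by force
  \<comment> \<open>On \<open>T\<close> the sign of \<open>r t q\<close> remains that of
    \<open>\<sigma>\<close>, so \<open>\<sigma> / r\<close> replaces
    \<open>1 / \<bar>r\<bar>\<close> and the density is rational in t.\<close>
  define \<rho> where "\<rho> = (\<lambda>t q. \<sigma> * (1 + (p t q)\<^sup>2 + (r t q)\<^sup>2) / (2 * r t q))"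
  have dens: "rel_area_density \<Omega> (w t) q = \<rho> t q" if t: "t \<in> T" and q: "q \<in> \<Omega>" for t q
  proof -
    note wv = variation_partials[where t = t, OF u op \<phi>2]
    have "\<forall>q\<in>\<Omega>. pd2 (w t) q \<noteq> 0"
      using rnz[OF t] wv(3) unfolding w_def r_def by simp
    then have "rel_area_density \<Omega> (w t) q = (1 + (p t q)\<^sup>2 + (r t q)\<^sup>2) / (2 * \<bar>r t q\<bar>)"
      using rel_area_density_eq[OF _ op _ q, of "w t"] wv q unfolding w_def p_def r_def by simp
    also have "\<bar>r t q\<bar> = \<sigma> * r t q"
      using r[OF t q] \<sigma> by (metis abs_mult abs_of_pos mult_1)
    also have "(1 + (p t q)\<^sup>2 + (r t q)\<^sup>2) / (2 * (\<sigma> * r t q)) = \<rho> t q"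
    proof -
      have "x / (2 * (\<sigma> * y)) = \<sigma> * x / (2 * y)" for x y
        using \<sigma> by (auto simp: abs_if split: if_splits)
      then show ?thesis by (simp only: \<rho>_def)
    qed
    finally show ?thesis .
  qed
  have c0: "continuous_on \<Omega> (w t)" "continuous_on \<Omega> (p t)" "continuous_on \<Omega> (r t)" for t
    unfolding w_def p_def r_def by (intro continuous_intros conts)+
  have c\<rho>: "continuous_on \<Omega> (\<rho> t)" if "t \<in> T" for t
    unfolding \<rho>_def by (intro continuous_intros c0) (use rnz that in auto)
  have w0: "w 0 = u" by (simp add: w_def)
  have "set_integrable lborel \<Omega> (rel_area_density \<Omega> (w 0)) = set_integrable lborel \<Omega> (\<rho> 0)"
    by (rule set_integrable_cong) (simp_all add: dens[OF T(3)])
  with area have area0: "set_integrable lborel \<Omega> (\<rho> 0)" by (simp add: w0)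
  obtain C where C: "\<And>q. q \<in> \<Omega> \<Longrightarrow> \<bar>u q\<bar> \<le> C"
    using bdd by (auto simp: bounded_iff)
  have moment0: "set_integrable lborel \<Omega> (\<lambda>q. w 0 q * \<rho> 0 q)"
    by (rule set_integrable_mult_bounded[OF op c0(1) c\<rho>[OF T(3)] area0, of _ C]) (use C w0 in auto)
  have energy: "energy_yz \<Omega> lam (w t)
      = (LINT q:\<Omega>|lborel. w t q * \<rho> t q) - lam * (LINT q:\<Omega>|lborel. \<rho> t q)" if t: "t \<in> T" for t
  proof -
    have "rel_integral \<Omega> (w t) fst = (LINT q:\<Omega>|lborel. w t q * \<rho> t q)"
      "rel_integral \<Omega> (w t) (\<lambda>_. 1) = (LINT q:\<Omega>|lborel. \<rho> t q)"
      unfolding rel_integral_def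
      by (rule set_lebesgue_integral_cong; use op dens[OF t] in \<open>simp add: graph_point_def\<close>)+
    then show ?thesis by (simp add: energy_yz_def)
  qed
  have sub': "\<Omega> \<subseteq> cbox A B" using sub box_subset_cbox by blast
  \<comment> \<open>The integrand of the energy difference. It vanishes off \<open>K\<close>, hence
    is continuous on the whole box whatever the density does at the frontier.\<close>
  define e where "e = (\<lambda>t q. if q \<in> \<Omega> then (w t q - lam) * \<rho> t q - (u q - lam) * \<rho> 0 q else 0)"
  have off: "w t q = u q" "p t q = p 0 q" "r t q = r 0 q" "\<rho> t q = \<rho> 0 q" if "q \<notin> K" for t q
    using van[OF that] K0[OF that] by (simp_all add: w_def p_def r_def \<rho>_def)
  have split: "energy_yz \<Omega> lam (w t) = energy_yz \<Omega> lam u + integral (cbox A B) (e t)"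
    and ce: "continuous_on UNIV (e t)" if t: "t \<in> T" for t
  proof -
    let ?e1 = "\<lambda>q. if q \<in> \<Omega> then w t q * \<rho> t q - w 0 q * \<rho> 0 q else 0"
    let ?e2 = "\<lambda>q. if q \<in> \<Omega> then \<rho> t q - \<rho> 0 q else 0"
    have eq: "w t q * \<rho> t q = w 0 q * \<rho> 0 q" "\<rho> t q = \<rho> 0 q" if "q \<in> \<Omega> - K" for q
      using off[of q] that by (simp_all add: w0)
    have c: "continuous_on \<Omega> (\<lambda>q. w s q * \<rho> s q)" if "s \<in> T" for s
      by (intro continuous_intros c0 c\<rho> that)
    note e1 = set_integral_perturb[OF op sub' clK K(2) moment0 c[OF T(3)] c[OF t] eq(1)]
    note e2 = set_integral_perturb[OF op sub' clK K(2) area0 c\<rho>[OF T(3)] c\<rho>[OF t] eq(2)]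
    have e: "e t = (\<lambda>q. ?e1 q - lam * ?e2 q)"
      by (auto simp: e_def w0 algebra_simps)
    show "continuous_on UNIV (e t)"
      unfolding e by (intro continuous_intros e1 e2)
    have "integral (cbox A B) (e t) = integral (cbox A B) ?e1 - integral (cbox A B) (\<lambda>q. lam * ?e2 q)"
      unfolding e
      by (intro integral_diff integrable_continuous continuous_intros
          continuous_on_subset[OF e1(1)] continuous_on_subset[OF e2(1)]) auto
    then show "energy_yz \<Omega> lam (w t) = energy_yz \<Omega> lam u + integral (cbox A B) (e t)"
      using energy[OF t] energy[OF T(3)] e1(2) e2(2) by (simp add: w0 algebra_simps)
  qed
  \<comment> \<open>The t-derivative of \<open>e\<close>; at t = 0 it is
    \<open>first_variation \<phi>\<close> extended by zero.\<close>
  define e' where "e' = (\<lambda>t q. if q \<in> \<Omega> then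
    \<sigma> * (\<phi> q * (1 + (p t q)\<^sup>2 + (r t q)\<^sup>2) / (2 * r t q) + (w t q - lam) *
      (p t q / r t q * pd1 \<phi> q + (1 - (1 + (p t q)\<^sup>2) / (r t q)\<^sup>2) / 2 * pd2 \<phi> q)) else 0)"
  have der: "((\<lambda>t. e t q) has_real_derivative e' t q) (at t within T)" if t: "t \<in> T" for t q
  proof (cases "q \<in> \<Omega>")
    case True
    note nz = rnz[OF t True]
    have "((\<lambda>t. w t q) has_real_derivative \<phi> q) (at t within T)"
      "((\<lambda>t. p t q) has_real_derivative pd1 \<phi> q) (at t within T)"
      "((\<lambda>t. r t q) has_real_derivative pd2 \<phi> q) (at t within T)"
      unfolding w_def p_def r_def by (auto intro!: derivative_eq_intros)
    note d = this
    have N: "((\<lambda>t. 1 + (p t q)\<^sup>2 + (r t q)\<^sup>2) has_real_derivative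
        2 * p t q * pd1 \<phi> q + 2 * r t q * pd2 \<phi> q) (at t within T)"
      by (auto intro!: derivative_eq_intros d)
    have "((\<lambda>t. (w t q - lam) * (\<sigma> * (1 + (p t q)\<^sup>2 + (r t q)\<^sup>2) / (2 * r t q)) - (u q - lam) * \<rho> 0 q)
        has_real_derivative e' t q) (at t within T)"
    proof (rule DERIV_cong)
      show "((\<lambda>t. (w t q - lam) * (\<sigma> * (1 + (p t q)\<^sup>2 + (r t q)\<^sup>2) / (2 * r t q)) - (u q - lam) * \<rho> 0 q)
        has_real_derivative
          (w t q - lam) * ((\<sigma> * (2 * p t q * pd1 \<phi> q + 2 * r t q * pd2 \<phi> q) * (2 * r t q)
            - \<sigma> * (1 + (p t q)\<^sup>2 + (r t q)\<^sup>2) * (2 * pd2 \<phi> q)) / (2 * r t q * (2 * r t q)))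
          + (\<phi> q - 0) * (\<sigma> * (1 + (p t q)\<^sup>2 + (r t q)\<^sup>2) / (2 * r t q)) - 0) (at t within T)"
        by (intro DERIV_diff DERIV_mult' DERIV_divide DERIV_cmult N d DERIV_const) (use nz in simp)
      define k where "k = inverse (r t q)"
      have k: "k * r t q = 1" using nz by (simp add: k_def)
      have dv: "z / r t q = z * k" "z / (r t q)\<^sup>2 = z * k\<^sup>2" "z / (2 * r t q) = z * k * (1 / 2)"
        "z / (2 * r t q * (2 * r t q)) = z * k\<^sup>2 * (1 / 4)" for z
        using nz by (simp_all add: k_def field_simps power2_eq_square)
      show "(w t q - lam) * ((\<sigma> * (2 * p t q * pd1 \<phi> q + 2 * r t q * pd2 \<phi> q) * (2 * r t q)
            - \<sigma> * (1 + (p t q)\<^sup>2 + (r t q)\<^sup>2) * (2 * pd2 \<phi> q)) / (2 * r t q * (2 * r t q)))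
          + (\<phi> q - 0) * (\<sigma> * (1 + (p t q)\<^sup>2 + (r t q)\<^sup>2) / (2 * r t q)) - 0 = e' t q"
        unfolding e'_def if_P[OF True] dv using k by algebra
    qed
    then show ?thesis using True by (simp add: e_def \<rho>_def)
  qed (simp add: e_def e'_def)
  \<comment> \<open>Joint continuity by gluing over the open sets \<open>T \<times> \<Omega>\<close>
    and \<open>T \<times> (- K)\<close>, which cover \<open>T \<times> cbox A B\<close> because
    \<open>K\<close> lies in \<open>\<Omega>\<close>; on the overlap \<open>\<phi>\<close> and its
    partials are 0.\<close>
  have ce': "continuous_on (T \<times> cbox A B) (\<lambda>(t, q). e' t q)"
  proof -
    define h where "h = (\<lambda>x. \<sigma> * (\<phi> (snd x) * (1 + (p (fst x) (snd x))\<^sup>2 + (r (fst x) (snd x))\<^sup>2)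
        / (2 * r (fst x) (snd x)) + (w (fst x) (snd x) - lam) *
      (p (fst x) (snd x) / r (fst x) (snd x) * pd1 \<phi> (snd x)
        + (1 - (1 + (p (fst x) (snd x))\<^sup>2) / (r (fst x) (snd x))\<^sup>2) / 2 * pd2 \<phi> (snd x))))"
    have c2: "continuous_on (T \<times> \<Omega>) (\<lambda>x. g (snd x))" if "continuous_on \<Omega> g" for g :: "point2 \<Rightarrow> real"
      by (rule continuous_on_compose2[OF that continuous_on_snd[OF continuous_on_id]]) auto
    note [continuous_intros] = conts[THEN c2]
    have [continuous_intros]: "continuous_on (T \<times> \<Omega>) (\<lambda>x. w (fst x) (snd x))"
      "continuous_on (T \<times> \<Omega>) (\<lambda>x. p (fst x) (snd x))"
      "continuous_on (T \<times> \<Omega>) (\<lambda>x. r (fst x) (snd x))"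
      unfolding w_def p_def r_def by (intro continuous_intros)+
    have "\<forall>x\<in>T \<times> \<Omega>. 2 * r (fst x) (snd x) \<noteq> 0" "\<forall>x\<in>T \<times> \<Omega>. (r (fst x) (snd x))\<^sup>2 \<noteq> 0"
      "\<forall>x\<in>T \<times> \<Omega>. r (fst x) (snd x) \<noteq> 0"
      by (intro ballI; simp add: rnz mem_Times_iff)+
    then have "continuous_on (T \<times> \<Omega>) h"
      unfolding h_def by (intro continuous_intros; (assumption | simp))
    then have "continuous_on (T \<times> \<Omega> \<union> T \<times> (- K)) (\<lambda>x. if x \<in> T \<times> \<Omega> then h x else 0)"
      by (rule continuous_on_extend_by_zero[OF open_Times[OF T(1) op] open_Times[OF T(1) open_Compl[OF clK]]])
        (simp add: h_def mem_Times_iff K0 van)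
    then have "continuous_on (T \<times> cbox A B) (\<lambda>x. if x \<in> T \<times> \<Omega> then h x else 0)"
      by (rule continuous_on_subset) (use K(2) in auto)
    then show ?thesis
      by (rule continuous_on_eq) (simp add: h_def e'_def split_beta mem_Times_iff)
  qed
  have "((\<lambda>t. integral (cbox A B) (e t)) has_real_derivative integral (cbox A B) (e' 0)) (at 0 within T)"
    by (rule leibniz_rule_field_derivative[OF der _ ce' T(3,2)])
      (auto intro!: integrable_continuous continuous_on_subset[OF ce])
  then have "((\<lambda>t. energy_yz \<Omega> lam u + integral (cbox A B) (e t)) has_real_derivative
      integral (cbox A B) (e' 0)) (at 0)"
    using DERIV_add[OF DERIV_const[of "energy_yz \<Omega> lam u"]] unfolding at_within_open[OF T(3,1)] by fastforce
  then have "((\<lambda>t. energy_yz \<Omega> lam (w t)) has_real_derivative integral (cbox A B) (e' 0)) (at 0)"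
    by (rule has_field_derivative_transform_within_open[OF _ T(1,3)]) (simp add: split)
  moreover have "e' 0 = (\<lambda>q. if q \<in> \<Omega> then first_variation \<phi> q else 0)"
    by (simp add: e'_def first_variation_def Let_def w_def p_def r_def fun_eq_iff)
  ultimately show ?thesis by (simp add: w_def)
qed

text \<open>By uniqueness of derivatives, criticality means that \<open>euler_lagrange\<close>
  integrates to 0 against every variation field; the fundamental lemma makes this pointwise.\<close>

lemma critical_iff_euler_lagrange:
  "(\<forall>\<phi>. variation_field \<Omega> \<phi> \<longrightarrow>
      ((\<lambda>t. energy_yz \<Omega> lam (\<lambda>q. u q + t * \<phi> q)) has_real_derivative 0) (at 0))
    \<longleftrightarrow> (\<forall>q\<in>\<Omega>. euler_lagrange q = 0)"
proof
  assume crit: "\<forall>\<phi>. variation_field \<Omega> \<phi> \<longrightarrow>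
      ((\<lambda>t. energy_yz \<Omega> lam (\<lambda>q. u q + t * \<phi> q)) has_real_derivative 0) (at 0)"
  have nz: "\<forall>q\<in>\<Omega>. pd2 u q \<noteq> 0" using pos by force
  have "continuous_on \<Omega> euler_lagrange"
    unfolding euler_lagrange_def Let_def
    by (intro continuous_intros C2_on_continuous[OF u op]) (use nz in simp_all)
  moreover have "integral (cbox A B) (\<lambda>q. if q \<in> \<Omega> then euler_lagrange q * \<phi> q else 0) = 0"
    if "variation_field \<Omega> \<phi>" for \<phi>
    using DERIV_unique[OF energy_has_derivative[OF that]] crit that
    unfolding integral_first_variation[OF that] by blast
  ultimately show "\<forall>q\<in>\<Omega>. euler_lagrange q = 0"
    using fundamental_lemma_calculus_of_variations[OF op sub] by blast
next
  assume EL: "\<forall>q\<in>\<Omega>. euler_lagrange q = 0"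
  have "integral (cbox A B) (\<lambda>q. if q \<in> \<Omega> then first_variation \<phi> q else 0) = 0"
    if "variation_field \<Omega> \<phi>" for \<phi>
  proof -
    have "(\<lambda>q. if q \<in> \<Omega> then euler_lagrange q * \<phi> q else 0) = (\<lambda>q. 0)" using EL by auto
    then show ?thesis using integral_first_variation[OF that] by simp
  qed
  then show "\<forall>\<phi>. variation_field \<Omega> \<phi> \<longrightarrow>
      ((\<lambda>t. energy_yz \<Omega> lam (\<lambda>q. u q + t * \<phi> q)) has_real_derivative 0) (at 0)"
    using energy_has_derivative by fastforce
qed

text \<open>Since \<open>x / 0 = 0\<close>, at a point with \<open>u w = lam\<close> the curvature
  equation would read \<open>H = 0\<close> and might hold; the inequality excludes this. So does the
  Euler-Lagrange equation, which is \<open>1 / q = (u w - lam) * S\<close> with nonzero left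
  side.\<close>

lemma euler_lagrange_eq_0_iff:
  assumes w: "w \<in> \<Omega>"
  defines "M \<equiv> graph_yz \<Omega> u" and "r \<equiv> graph_point u w"
  shows "euler_lagrange w = 0 \<longleftrightarrow> u w \<noteq> lam \<and>
    mean_curvature M r = iso_inner (N_par M r) X_field / (2 * (u w - lam))"
proof -
  define p q a b c d where "p = pd1 u w" and "q = pd2 u w" and "a = pd1 (pd1 u) w"
    and "b = pd2 (pd1 u) w" and "c = pd1 (pd2 u) w" and "d = pd2 (pd2 u) w"
  note defs = p_def q_def a_def b_def c_def d_def
  have nz: "\<forall>q\<in>\<Omega>. pd2 u q \<noteq> 0" using pos by force
  then have q0: "q \<noteq> 0" using w by (simp add: q_def)
  note nf = normal_form_derivatives[OF u op nz w, folded M_def r_def defs]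
  define S where "S = a / q - p * c / q\<^sup>2 - p * b / q\<^sup>2 + (1 + p\<^sup>2) * d / q ^ 3"
  have H: "mean_curvature M r = - S / 2"
    unfolding mean_curvature_def Let_def nf S_def by (simp add: add_divide_distrib diff_divide_distrib distrib_right)
  have N: "iso_inner (N_par M r) X_field = - (1 / q)"
    unfolding N_par_def Let_def nf X_field_def by simp
  have "\<sigma> \<noteq> 0" using \<sigma> by auto
  then have "euler_lagrange w = 0 \<longleftrightarrow> 1 / q = (u w - lam) * S"
    unfolding euler_lagrange_def Let_def S_def by (simp add: defs)
  also have "\<dots> \<longleftrightarrow> u w \<noteq> lam \<and> - S / 2 = - (1 / q) / (2 * (u w - lam))"
    using q0 by (cases "u w = lam") (auto simp: field_simps)
  finally show ?thesis unfolding H N .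
qed

end

section \<open>Criticality, mean curvature and the distance to the plane\<close>

theorem theorem7:
  fixes \<Omega> :: "(real \<times> real) set" and u :: "real \<times> real \<Rightarrow> real"
    and M \<Gamma> :: "(real \<times> real \<times> real) set" and A0 lam :: real
  assumes "open \<Omega>" and "connected \<Omega>" and "\<Omega> \<noteq> {}" and "bounded \<Omega>"
    and "C2_on \<Omega> u" and "continuous_on (closure \<Omega>) u"
    and "M = graph_yz \<Omega> u" and "M \<subseteq> half_space_yz" and "admissible_yz \<Omega> u"
    and "\<Gamma> = boundary_yz \<Omega> u" and "has_rel_area \<Omega> u A0"
  shows "energy_yz \<Omega> lam u = rel_integral \<Omega> u (\<lambda>p. fst p - lam) \<and>
    (critical_point_yz \<Omega> \<Gamma> A0 lam u \<longleftrightarrow>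
      (\<forall>r\<in>M. fst r \<noteq> lam \<and>
        mean_curvature M r = iso_inner (N_par M r) X_field / (2 * (fst r - lam)))) \<and>
    (critical_point_yz \<Omega> \<Gamma> A0 lam u \<longleftrightarrow>
      (\<forall>r\<in>M. iso_dist_set r plane_yz \<noteq> lam \<and>
        mean_curvature M r =
          iso_inner (N_par M r) X_field / (2 * (iso_dist_set r plane_yz - lam))))"
proof -
  have nz: "\<forall>q\<in>\<Omega>. pd2 u q \<noteq> 0" using assms(9) by (simp add: admissible_yz_iff)
  have area: "set_integrable lborel \<Omega> (rel_area_density \<Omega> u)"
    using assms(11) by (simp add: has_rel_area_def)
  have "compact (u ` closure \<Omega>)"
    using compact_continuous_image[OF assms(6)] assms(4) by simp
  then have bdd: "bounded (u ` \<Omega>)"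
    by (rule bounded_subset[OF compact_imp_bounded image_mono[OF closure_subset]])
  obtain B where B: "\<Omega> \<subseteq> box (- B) B"
    using bounded_subset_box_symmetric[OF assms(4)] by blast
  \<comment> \<open>The source of \<open>\<sigma>\<close>: the image of the connected domain under
    \<open>pd2 u\<close> is an interval that avoids 0.\<close>
  have "connected (pd2 u ` \<Omega>)"
    using connected_continuous_image[OF C2_on_continuous(3)[OF assms(5,1)] assms(2)] .
  then have ivl: "0 \<in> pd2 u ` \<Omega>" if "x \<in> \<Omega>" "y \<in> \<Omega>" "pd2 u x \<le> 0" "0 \<le> pd2 u y" for x y
    using that unfolding connected_iff_interval by blast
  have "(\<forall>q\<in>\<Omega>. pd2 u q > 0) \<or> (\<forall>q\<in>\<Omega>. pd2 u q < 0)"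
  proof (rule ccontr)
    assume "\<not> ?thesis"
    then obtain x y where "x \<in> \<Omega>" "y \<in> \<Omega>" "pd2 u x \<le> 0" "0 \<le> pd2 u y"
      by (auto simp: not_less)
    from ivl[OF this] nz show False by auto
  qed
  then obtain \<sigma> :: real where \<sigma>: "\<bar>\<sigma>\<bar> = 1" "\<forall>q\<in>\<Omega>. \<sigma> * pd2 u q > 0"
  proof
    assume "\<forall>q\<in>\<Omega>. pd2 u q > 0"
    then show ?thesis using that[of 1] by simp
  next
    assume "\<forall>q\<in>\<Omega>. pd2 u q < 0"
    then show ?thesis using that[of "- 1"] by simp
  qed
  note EL = assms(1) B assms(5) bdd \<sigma> area
  have "u \<in> graph_class \<Omega> \<Gamma> A0"
    using assms by (simp add: graph_class_def)
  then have crit: "critical_point_yz \<Omega> \<Gamma> A0 lam u \<longleftrightarrow>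
      (\<forall>r\<in>M. fst r \<noteq> lam \<and>
        mean_curvature M r = iso_inner (N_par M r) X_field / (2 * (fst r - lam)))"
    using critical_iff_euler_lagrange[OF EL] euler_lagrange_eq_0_iff[OF EL]
    unfolding critical_point_yz_def assms(7) graph_yz_def by (auto simp: graph_point_def)
  \<comment> \<open>On \<open>M\<close> the coordinate x is positive, so the distance
    \<open>\<bar>x\<bar>\<close> equals x and the two forms of the curvature equation
    coincide.\<close>
  moreover have "iso_dist_set r plane_yz = fst r" if "r \<in> M" for r
    using that assms(8) by (auto simp: iso_dist_set_plane_yz half_space_yz_def)
  \<comment> \<open>A Lebesgue integral defaults to 0 on a non-integrable function, so linearity
    needs both parts integrable; for the moment this follows from the boundedness of
    \<open>u\<close>.\<close>
  moreover have "energy_yz \<Omega> lam u = rel_integral \<Omega> u (\<lambda>p. fst p - lam)"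
  proof -
    have "continuous_on \<Omega> (\<lambda>q. (1 + (pd1 u q)\<^sup>2 + (pd2 u q)\<^sup>2) / (2 * \<bar>pd2 u q\<bar>))"
      by (intro continuous_intros C2_on_continuous[OF assms(5,1)]) (use nz in auto)
    then have c: "continuous_on \<Omega> (rel_area_density \<Omega> u)"
      by (rule continuous_on_eq) (simp add: rel_area_density_eq[OF assms(5,1) nz])
    obtain C where "\<And>q. q \<in> \<Omega> \<Longrightarrow> \<bar>u q\<bar> \<le> C"
      using bdd by (auto simp: bounded_iff)
    then have "set_integrable lborel \<Omega> (\<lambda>q. u q * rel_area_density \<Omega> u q)"
      by (rule set_integrable_mult_bounded[OF assms(1) C2_on_continuous(1)[OF assms(5,1)] c area])
    then show ?thesis
      unfolding energy_yz_def rel_integral_def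
      using set_integral_diff(2)[OF _ set_integrable_mult_right[OF area], of "\<lambda>q. u q * rel_area_density \<Omega> u q" lam]
      by (simp add: graph_point_def left_diff_distrib area)
  qed
  ultimately show ?thesis by simp
qed

end
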